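(* Let $\mathcal A$ be a unital $^*$-algebra over $\mathsf C$ and let $P_0\in M_n(\mathcal A)$ be a projection. Let $\boldsymbol{\mathcal A}=(\mathcal A[[\lambda]],\star)$ be a Hermitian deformation of $\mathcal A$, and consider the right $\mathcal A$-module $\mathcal E=P_0\mathcal A^n$ equipped with its canonical $\mathcal A$-valued inner product $h_0$, so that $(\mathcal E,h_0)$ is an inner-product module (in particular $h_0$ is positive definite). Then there exists a Hermitian deformation of $(\mathcal E,h_0)$ corresponding to $\boldsymbol{\mathcal A}$, and it is unique up to equivalence of Hermitian deformations.
   Context: $\mathsf R$ is an ordered ring (commutative, associative, unital, with a subset of positive elements closed under sums and products such that $\mathsf R$ is the disjoint union of negatives, $\{0\}$ and positives), with $\mathbb Q\subseteq\mathsf R$, and $\mathsf C=\mathsf R(\mathrm i)$, $\mathrm i^2=-1$. $\mathsf R[[\lambda]]$ is ordered by: $\sum_r a_r\lambda^r>0$ iff the first nonvanishing coefficient is positive. A $^*$-algebra over $\mathsf C$ is an associative $\mathsf C$-algebra with an involutive $\mathsf C$-antilinear antiautomorphism $^*$. A linear functional $\omega:\mathcal A\to\mathsf C$ is positive if $\omega(A^*A)\ge0$ for all $A$; $\mathcal A^+$ is the set of $A\in\mathcal A$ with $\omega(A)\ge0$ for every positive $\omega$. The same notions apply to $^*$-algebras over $\mathsf C[[\lambda]]$. A formal deformation of $\mathcal A$ is an associative $\mathsf C[[\lambda]]$-bilinear product $\star$ on $\mathcal A[[\lambda]]$, $A\star A'=\sum_{r\ge0}C_r(A,A')\lambda^r$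 for $A,A'\in\mathcal A$, with $C_r$ $\mathsf C$-bilinear, $C_0$ the original product and the unit of $\mathcal A$ still a unit for $\star$; it is Hermitian if $(A\star A')^*=A'^*\star A^*$. $M_n(\mathcal A)$ carries the involution $(L^* )_{ij}=(L_{ji})^*$; a projection is an element $P_0=P_0^2=P_0^*$. The canonical inner product $h_0$ on $P_0\mathcal A^n$ is the restriction of $\langle x,y\rangle=\sum_{i=1}^n x_i^*y_i$ on $\mathcal A^n$. An inner-product module over $\mathcal A$ is a finitely generated projective right $\mathcal A$-module $\mathcal E$ with a positive definite, $\mathcal A$-valued, $\mathcal A$-right linear inner product $h_0:\mathcal E\times\mathcal E\to\mathcal A$, i.e. $h_0(x,\alpha y+\beta z)=\alpha h_0(x,y)+\beta h_0(x,z)$, $h_0(x,y)^*=h_0(y,x)$, $h_0(x,y\cdot A)=h_0(x,y)A$, $h_0(x,x)\in\mathcal A^+$, and $h_0(x,x)=0\Rightarrow x=0$. A Hermitian deformation of $(\mathcal E,h_0)$ corresponding to $\boldsymbol{\mathcal A}$ is a triple $(\mathcal E[[\lambda]],\bullet,\boldsymbol h)$, where $x\bullet A=\sum_{r\ge0}R_r(x,A)\lambda^r$ (with $R_r:\mathcal E\times\mathcal A\to\mathcal E$ $\mathsf C$-bilinear, $R_0(x,A)=x\cdot A$) makes $\mathcal E[[\lambda]]$ a right $\boldsymbol{\mathcal A}$-module, and $\boldsymbol h=\sum_{r\ge0}h_r\lambda^r$, $h_r:\mathcal E\times\mathcal E\to\mathcal A$, with zeroth order term $h_0$, is a positive definite,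 $\boldsymbol{\mathcal A}$-valued, $\boldsymbol{\mathcal A}$-right linear inner product on $\mathcal E[[\lambda]]$ (same axioms, over $\mathsf C[[\lambda]]$ and $\boldsymbol{\mathcal A}$). Two Hermitian deformations $(\mathcal E[[\lambda]],\bullet,\boldsymbol h)$ and $(\mathcal E[[\lambda]],\bullet',\boldsymbol h')$ are equivalent if there is an $\boldsymbol{\mathcal A}$-module isomorphism $\boldsymbol T=\mathrm{id}+\sum_{r\ge1}T_r\lambda^r$ from the first to the second, with $T_r:\mathcal E\to\mathcal E$ $\mathsf C$-linear, satisfying $\boldsymbol h'(\boldsymbol T(x),\boldsymbol T(y))=\boldsymbol h(x,y)$. *)

theory Defs
  imports "HOL-Analysis.Analysis" "HOL-Computational_Algebra.Formal_Power_Series"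
begin

section \<open>Ordered rings containing the rationals, and formal power series over them\<close>

text \<open>
  The classes \<open>linordered_idom\<close> and ``ordered ring'' agree: trichotomy and closure of the
  positive elements under products exclude zero divisors.
\<close>

class rat_ordered_ring = linordered_idom +
  assumes rat_embedding:
    "\<exists>\<iota> :: rat \<Rightarrow> 'a. inj \<iota> \<and> \<iota> 1 = 1 \<and> (\<forall>p q. \<iota> (p + q) = \<iota> p + \<iota> q \<and> \<iota> (p * q) = \<iota> p * \<iota> q)"

text \<open>
  A power series is positive iff its first nonvanishing coefficient is; \<open>subdegree\<close> is the
  index of that coefficient (and \<open>0\<close> for the zero series).
\<close>

instantiation fps :: (linordered_idom) linordered_idom
begin

definition less_fps_def:
  "(f :: 'a fps) < g \<longleftrightarrow> 0 < fps_nth (g - f) (subdegree (g - f))"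

definition less_eq_fps_def:
  "(f :: 'a fps) \<le> g \<longleftrightarrow> f = g \<or> f < g"

definition abs_fps_def:
  "\<bar>f :: 'a fps\<bar> = (if f < 0 then - f else f)"

definition sgn_fps_def:
  "sgn (f :: 'a fps) = (if f = 0 then 0 else if 0 < f then 1 else - 1)"

instance
proof -
  define pos :: "'a fps \<Rightarrow> bool" where "pos = (\<lambda>f. 0 < fps_nth f (subdegree f))"
  have less: "f < g \<longleftrightarrow> pos (g - f)" for f g :: "'a fps"
    by (simp add: less_fps_def pos_def)
  have not0: "\<not> pos 0"
    by (simp add: pos_def)
  have tri: "f = 0 \<or> pos f \<or> pos (- f)" for f
    by (cases "f = 0") (auto simp: pos_def not_less_iff_gr_or_eq neq_iff dest: nth_subdegree_nonzero)
  have anti: "\<not> pos (- f)" if "pos f" for f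
    using that by (simp add: pos_def)
  have mult: "pos (f * g)" if "pos f" "pos g" for f g
  proof -
    have "f \<noteq> 0" "g \<noteq> 0"
      using that not0 by auto
    then show ?thesis
      using that by (simp add: pos_def)
  qed
  have add: "pos (f + g)" if f: "pos f" and g: "pos g" for f g
  proof -
    have *: "pos (f + g)" if f: "pos f" and g: "pos g" and le: "subdegree f \<le> subdegree g" for f g
    proof -
      have "0 \<le> fps_nth g (subdegree f)"
        using g le by (cases "subdegree f = subdegree g") (auto simp: pos_def le_less intro: nth_less_subdegree_zero)
      then have p: "0 < fps_nth (f + g) (subdegree f)"
        using f by (simp add: pos_def)
      have "fps_nth (f + g) i = 0" if "i < subdegree f" for i
        using that le by (simp add: nth_less_subdegree_zero)
      then have "subdegree (f + g) = subdegree f"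
        using p by (intro subdegreeI) auto
      with p show ?thesis
        by (simp add: pos_def)
    qed
    show ?thesis
      using *[OF f g] *[OF g f] by (cases "subdegree f \<le> subdegree g") (auto simp: add.commute)
  qed
  show "OFCLASS('a fps, linordered_idom_class)"
  proof
    fix f g h :: "'a fps"
    show "f < g \<longleftrightarrow> f \<le> g \<and> \<not> g \<le> f"
      using anti[of "g - f"] not0 by (auto simp: less_eq_fps_def less)
    show "f \<le> f"
      by (simp add: less_eq_fps_def)
    show "f \<le> h" if "f \<le> g" "g \<le> h"
      using that add[of "g - f" "h - g"] by (auto simp: less_eq_fps_def less)
    show "f = g" if "f \<le> g" "g \<le> f"
      using that anti[of "g - f"] by (auto simp: less_eq_fps_def less)
    show "f \<le> g \<or> g \<le> f"
      using tri[of "g - f"] by (auto simp: less_eq_fps_def less)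
    show "h + f \<le> h + g" if "f \<le> g"
      using that by (auto simp: less_eq_fps_def less)
    show "h * f < h * g" if "f < g" "0 < h"
      using that mult[of h "g - f"] by (auto simp: less algebra_simps)
    show "\<bar>f\<bar> = (if f < 0 then - f else f)"
      by (rule abs_fps_def)
    show "sgn f = (if f = 0 then 0 else if 0 < f then 1 else - 1)"
      by (rule sgn_fps_def)
  qed
qed

end

instance fps :: (rat_ordered_ring) rat_ordered_ring
proof
  obtain \<iota> :: "rat \<Rightarrow> 'a" where
    "inj \<iota>" "\<iota> 1 = 1" "\<And>p q. \<iota> (p + q) = \<iota> p + \<iota> q" "\<And>p q. \<iota> (p * q) = \<iota> p * \<iota> q"
    using rat_embedding by blast
  then show "\<exists>\<iota> :: rat \<Rightarrow> 'a fps. inj \<iota> \<and> \<iota> 1 = 1 \<and>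
      (\<forall>p q. \<iota> (p + q) = \<iota> p + \<iota> q \<and> \<iota> (p * q) = \<iota> p * \<iota> q)"
    by (intro exI[of _ "\<lambda>q. fps_const (\<iota> q)"]) (auto simp: inj_def)
qed


section \<open>The ring extension by a square root of minus one\<close>

datatype 'r cx = Cx (cx_re: 'r) (cx_im: 'r)

instantiation cx :: (comm_ring_1) comm_ring_1
begin

definition "0 = Cx 0 0"
definition "1 = Cx 1 0"
definition "z + w = Cx (cx_re z + cx_re w) (cx_im z + cx_im w)"
definition "z - w = Cx (cx_re z - cx_re w) (cx_im z - cx_im w)"
definition "- z = Cx (- cx_re z) (- cx_im z)"
definition "z * w = Cx (cx_re z * cx_re w - cx_im z * cx_im w) (cx_re z * cx_im w + cx_im z * cx_re w)"

instance
  by standard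
    (auto simp: zero_cx_def one_cx_def plus_cx_def minus_cx_def uminus_cx_def times_cx_def algebra_simps)

end

definition cx_cnj :: "'r::comm_ring_1 cx \<Rightarrow> 'r cx"
  where "cx_cnj z = Cx (cx_re z) (- cx_im z)"

definition cx_nonneg :: "'r::linordered_idom cx \<Rightarrow> bool"
  where "cx_nonneg z \<longleftrightarrow> 0 \<le> cx_re z \<and> cx_im z = 0"


section \<open>Algebras, involutions and positivity\<close>

text \<open>
  Multiplications are passed explicitly, since the undeformed and the deformed algebra have
  different underlying types and the deformed product is not the product of a type class.
  The zero algebra is allowed.
\<close>

definition lin_on :: "('c \<Rightarrow> 'x \<Rightarrow> 'x) \<Rightarrow> 'x set \<Rightarrow> ('c \<Rightarrow> 'y \<Rightarrow> 'y) \<Rightarrow>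
    ('x::ab_group_add \<Rightarrow> 'y::ab_group_add) \<Rightarrow> bool"
  where "lin_on s X t f \<longleftrightarrow>
    (\<forall>x\<in>X. \<forall>y\<in>X. f (x + y) = f x + f y) \<and> (\<forall>c. \<forall>x\<in>X. f (s c x) = t c (f x))"

definition bilin_on :: "('c \<Rightarrow> 'x \<Rightarrow> 'x) \<Rightarrow> 'x set \<Rightarrow> ('c \<Rightarrow> 'y \<Rightarrow> 'y) \<Rightarrow> 'y set \<Rightarrow> ('c \<Rightarrow> 'z \<Rightarrow> 'z) \<Rightarrow>
    ('x::ab_group_add \<Rightarrow> 'y::ab_group_add \<Rightarrow> 'z::ab_group_add) \<Rightarrow> bool"
  where "bilin_on s X t Y u B \<longleftrightarrow>
    (\<forall>y\<in>Y. lin_on s X u (\<lambda>x. B x y)) \<and> (\<forall>x\<in>X. lin_on t Y u (B x))"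

locale unital_algebra = module scl
  for scl :: "'c::comm_ring_1 \<Rightarrow> 'a::ab_group_add \<Rightarrow> 'a" +
  fixes mul :: "'a \<Rightarrow> 'a \<Rightarrow> 'a" and one :: 'a
  assumes mul_bilinear: "bilin_on scl UNIV scl UNIV scl mul"
    and mul_assoc: "mul (mul a b) c = mul a (mul b c)"
    and one_left: "mul one a = a"
    and one_right: "mul a one = a"

locale unital_star_algebra = unital_algebra scl mul one
  for scl :: "'r::rat_ordered_ring cx \<Rightarrow> 'a::ab_group_add \<Rightarrow> 'a" and mul one +
  fixes star :: "'a \<Rightarrow> 'a"
  assumes star_add: "star (a + b) = star a + star b"
    and star_scale: "star (scl z a) = scl (cx_cnj z) (star a)"
    and star_mul: "star (mul a b) = mul (star b) (star a)"
    and star_star: "star (star a) = a"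

definition positive_functional :: "('r::rat_ordered_ring cx \<Rightarrow> 'a \<Rightarrow> 'a) \<Rightarrow> ('a \<Rightarrow> 'a \<Rightarrow> 'a) \<Rightarrow>
    ('a \<Rightarrow> 'a) \<Rightarrow> ('a::ab_group_add \<Rightarrow> 'r cx) \<Rightarrow> bool"
  where "positive_functional scl mul star \<omega> \<longleftrightarrow>
    module_hom scl (*) \<omega> \<and> (\<forall>a. cx_nonneg (\<omega> (mul (star a) a)))"

definition positive_elements :: "('r::rat_ordered_ring cx \<Rightarrow> 'a \<Rightarrow> 'a) \<Rightarrow> ('a \<Rightarrow> 'a \<Rightarrow> 'a) \<Rightarrow>
    ('a \<Rightarrow> 'a) \<Rightarrow> 'a::ab_group_add set"
  where "positive_elements scl mul star =
    {a. \<forall>\<omega>. positive_functional scl mul star \<omega> \<longrightarrow> cx_nonneg (\<omega> a)}"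


section \<open>Inner-product modules\<close>

text \<open>
  Modules are submodules \<open>E\<close> of an ambient type; all conditions are relative to \<open>E\<close>.
\<close>

definition right_module :: "('c::comm_ring_1 \<Rightarrow> 'a \<Rightarrow> 'a) \<Rightarrow> ('a \<Rightarrow> 'a \<Rightarrow> 'a) \<Rightarrow> 'a \<Rightarrow>
    ('c \<Rightarrow> 'e \<Rightarrow> 'e) \<Rightarrow> 'e set \<Rightarrow> ('e::ab_group_add \<Rightarrow> 'a::ab_group_add \<Rightarrow> 'e) \<Rightarrow> bool"
  where "right_module scl mul one sE E act \<longleftrightarrow>
    module sE \<and> module.subspace sE E \<and>
    (\<forall>x\<in>E. \<forall>a. act x a \<in> E) \<and>
    bilin_on sE E scl UNIV sE act \<and>
    (\<forall>x\<in>E. \<forall>a b. act (act x a) b = act x (mul a b)) \<and>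
    (\<forall>x\<in>E. act x one = x)"

text \<open>
  Finitely generated projective: a direct summand of the free right module of rank \<open>m\<close>, for
  some \<open>m\<close>. The free module consists of the functions on \<open>nat\<close> that vanish from \<open>m\<close> on.
\<close>

definition fg_projective :: "('a \<Rightarrow> 'a \<Rightarrow> 'a) \<Rightarrow> 'e set \<Rightarrow>
    ('e::ab_group_add \<Rightarrow> 'a::ab_group_add \<Rightarrow> 'e) \<Rightarrow> bool"
  where "fg_projective mul E act \<longleftrightarrow>
    (\<exists>m. \<exists>(\<iota> :: 'e \<Rightarrow> nat \<Rightarrow> 'a) (\<pi> :: (nat \<Rightarrow> 'a) \<Rightarrow> 'e).
      let F = {v. \<forall>i\<ge>m. v i = 0} in
      (\<forall>x\<in>E. \<iota> x \<in> F) \<and>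
      (\<forall>x\<in>E. \<forall>y\<in>E. \<iota> (x + y) = (\<lambda>i. \<iota> x i + \<iota> y i)) \<and>
      (\<forall>x\<in>E. \<forall>a. \<iota> (act x a) = (\<lambda>i. mul (\<iota> x i) a)) \<and>
      (\<forall>v\<in>F. \<pi> v \<in> E) \<and>
      (\<forall>v\<in>F. \<forall>w\<in>F. \<pi> (\<lambda>i. v i + w i) = \<pi> v + \<pi> w) \<and>
      (\<forall>v\<in>F. \<forall>a. \<pi> (\<lambda>i. mul (v i) a) = act (\<pi> v) a) \<and>
      (\<forall>x\<in>E. \<pi> (\<iota> x) = x))"

definition inner_product :: "('r::rat_ordered_ring cx \<Rightarrow> 'a \<Rightarrow> 'a) \<Rightarrow> ('a \<Rightarrow> 'a \<Rightarrow> 'a) \<Rightarrow> ('a \<Rightarrow> 'a) \<Rightarrow>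
    ('r cx \<Rightarrow> 'e \<Rightarrow> 'e) \<Rightarrow> 'e set \<Rightarrow> ('e::ab_group_add \<Rightarrow> 'a::ab_group_add \<Rightarrow> 'e) \<Rightarrow>
    ('e \<Rightarrow> 'e \<Rightarrow> 'a) \<Rightarrow> bool"
  where "inner_product scl mul star sE E act h \<longleftrightarrow>
    (\<forall>x\<in>E. \<forall>y\<in>E. \<forall>z\<in>E. \<forall>\<alpha> \<beta>. h x (sE \<alpha> y + sE \<beta> z) = scl \<alpha> (h x y) + scl \<beta> (h x z)) \<and>
    (\<forall>x\<in>E. \<forall>y\<in>E. star (h x y) = h y x) \<and>
    (\<forall>x\<in>E. \<forall>y\<in>E. \<forall>a. h x (act y a) = mul (h x y) a) \<and>
    (\<forall>x\<in>E. h x x \<in> positive_elements scl mul star) \<and>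
    (\<forall>x\<in>E. h x x = 0 \<longrightarrow> x = 0)"

definition inner_product_module :: "('r::rat_ordered_ring cx \<Rightarrow> 'a \<Rightarrow> 'a) \<Rightarrow> ('a \<Rightarrow> 'a \<Rightarrow> 'a) \<Rightarrow> 'a \<Rightarrow>
    ('a \<Rightarrow> 'a) \<Rightarrow> ('r cx \<Rightarrow> 'e \<Rightarrow> 'e) \<Rightarrow> 'e set \<Rightarrow>
    ('e::ab_group_add \<Rightarrow> 'a::ab_group_add \<Rightarrow> 'e) \<Rightarrow> ('e \<Rightarrow> 'e \<Rightarrow> 'a) \<Rightarrow> bool"
  where "inner_product_module scl mul one star sE E act h \<longleftrightarrow>
    right_module scl mul one sE E act \<and> fg_projective mul E act \<and>
    inner_product scl mul star sE E act h"


section \<open>Formal power series with coefficients in a module\<close>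

text \<open>
  The scalars for power series with coefficients in a module over \<open>'r cx\<close> are taken from
  \<open>'r fps cx\<close>, i.e. from \<open>R[[\<lambda>]](i)\<close>, which is \<open>C[[\<lambda>]]\<close>. As \<open>R[[\<lambda>]]\<close> is again an
  ordered ring, the notions above apply to it verbatim.
\<close>

definition cx_nth :: "'r::zero fps cx \<Rightarrow> nat \<Rightarrow> 'r cx"
  where "cx_nth z k = Cx (fps_nth (cx_re z) k) (fps_nth (cx_im z) k)"

definition fps_scale :: "('r::comm_ring_1 cx \<Rightarrow> 'x \<Rightarrow> 'x) \<Rightarrow> 'r fps cx \<Rightarrow> 'x::ab_group_add fps \<Rightarrow> 'x fps"
  where "fps_scale scl z f = Abs_fps (\<lambda>n. \<Sum>k\<le>n. scl (cx_nth z k) (fps_nth f (n - k)))"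

definition fps_star :: "('a \<Rightarrow> 'a) \<Rightarrow> 'a fps \<Rightarrow> 'a fps"
  where "fps_star star f = Abs_fps (\<lambda>n. star (fps_nth f n))"

definition fps_over :: "'e set \<Rightarrow> 'e fps set"
  where "fps_over E = {f. \<forall>n. fps_nth f n \<in> E}"


section \<open>Deformations\<close>

definition formal_deformation :: "('r::rat_ordered_ring cx \<Rightarrow> 'a \<Rightarrow> 'a) \<Rightarrow> ('a \<Rightarrow> 'a \<Rightarrow> 'a) \<Rightarrow> 'a \<Rightarrow>
    ('a::ab_group_add fps \<Rightarrow> 'a fps \<Rightarrow> 'a fps) \<Rightarrow> bool"
  where "formal_deformation scl mul one smul \<longleftrightarrow>
    unital_algebra (fps_scale scl) smul (fps_const one) \<and>
    (\<exists>C :: nat \<Rightarrow> 'a \<Rightarrow> 'a \<Rightarrow> 'a.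
      (\<forall>r. bilin_on scl UNIV scl UNIV scl (C r)) \<and>
      (\<forall>a b. smul (fps_const a) (fps_const b) = Abs_fps (\<lambda>r. C r a b)) \<and>
      C 0 = mul)"

definition hermitian_deformation :: "('r::rat_ordered_ring cx \<Rightarrow> 'a \<Rightarrow> 'a) \<Rightarrow> ('a \<Rightarrow> 'a \<Rightarrow> 'a) \<Rightarrow> 'a \<Rightarrow>
    ('a \<Rightarrow> 'a) \<Rightarrow> ('a::ab_group_add fps \<Rightarrow> 'a fps \<Rightarrow> 'a fps) \<Rightarrow> bool"
  where "hermitian_deformation scl mul one star smul \<longleftrightarrow>
    formal_deformation scl mul one smul \<and>
    (\<forall>f g. fps_star star (smul f g) = smul (fps_star star g) (fps_star star f))"

text \<open>
  The deformed action and inner product are functions on all of \<open>E[[\<lambda>]]\<close>; the series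
  \<open>R\<close> and \<open>hr\<close> describe their values on constant series, which determine them because
  of the bilinearity (resp. sesquilinearity) over \<open>C[[\<lambda>]]\<close>.
\<close>

definition hermitian_module_deformation :: "('r::rat_ordered_ring cx \<Rightarrow> 'a \<Rightarrow> 'a) \<Rightarrow> 'a \<Rightarrow> ('a \<Rightarrow> 'a) \<Rightarrow>
    ('a fps \<Rightarrow> 'a fps \<Rightarrow> 'a fps) \<Rightarrow>
    ('r cx \<Rightarrow> 'e \<Rightarrow> 'e) \<Rightarrow> 'e set \<Rightarrow> ('e \<Rightarrow> 'a \<Rightarrow> 'e) \<Rightarrow> ('e \<Rightarrow> 'e \<Rightarrow> 'a) \<Rightarrow>
    ('e::ab_group_add fps \<Rightarrow> 'a::ab_group_add fps \<Rightarrow> 'e fps) \<Rightarrow> ('e fps \<Rightarrow> 'e fps \<Rightarrow> 'a fps) \<Rightarrow> bool"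
  where "hermitian_module_deformation scl one star smul sE E act h0 bact h \<longleftrightarrow>
    right_module (fps_scale scl) smul (fps_const one) (fps_scale sE) (fps_over E) bact \<and>
    (\<exists>R :: nat \<Rightarrow> 'e \<Rightarrow> 'a \<Rightarrow> 'e.
      (\<forall>r. \<forall>x\<in>E. \<forall>a. R r x a \<in> E) \<and>
      (\<forall>r. bilin_on sE E scl UNIV sE (R r)) \<and>
      (\<forall>x\<in>E. \<forall>a. bact (fps_const x) (fps_const a) = Abs_fps (\<lambda>r. R r x a)) \<and>
      (\<forall>x\<in>E. \<forall>a. R 0 x a = act x a)) \<and>
    inner_product (fps_scale scl) smul (fps_star star) (fps_scale sE) (fps_over E) bact h \<and>
    (\<exists>hr :: nat \<Rightarrow> 'e \<Rightarrow> 'e \<Rightarrow> 'a.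
      (\<forall>x\<in>E. \<forall>y\<in>E. h (fps_const x) (fps_const y) = Abs_fps (\<lambda>r. hr r x y)) \<and>
      (\<forall>x\<in>E. \<forall>y\<in>E. hr 0 x y = h0 x y))"

definition equivalent_deformations :: "('r::rat_ordered_ring cx \<Rightarrow> 'e \<Rightarrow> 'e) \<Rightarrow> 'e set \<Rightarrow>
    ('e::ab_group_add fps \<Rightarrow> 'a fps \<Rightarrow> 'e fps) \<Rightarrow> ('e fps \<Rightarrow> 'e fps \<Rightarrow> 'a::ab_group_add fps) \<Rightarrow>
    ('e fps \<Rightarrow> 'a fps \<Rightarrow> 'e fps) \<Rightarrow> ('e fps \<Rightarrow> 'e fps \<Rightarrow> 'a fps) \<Rightarrow> bool"
  where "equivalent_deformations sE E bact h bact' h' \<longleftrightarrow>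
    (\<exists>(T :: 'e fps \<Rightarrow> 'e fps) (Tr :: nat \<Rightarrow> 'e \<Rightarrow> 'e).
      (\<forall>r. \<forall>x\<in>E. Tr r x \<in> E) \<and>
      (\<forall>r. lin_on sE E sE (Tr r)) \<and>
      (\<forall>x\<in>E. Tr 0 x = x) \<and>
      (\<forall>x\<in>E. T (fps_const x) = Abs_fps (\<lambda>r. Tr r x)) \<and>
      lin_on (fps_scale sE) (fps_over E) (fps_scale sE) T \<and>
      bij_betw T (fps_over E) (fps_over E) \<and>
      (\<forall>x\<in>fps_over E. \<forall>a. T (bact x a) = bact' (T x) a) \<and>
      (\<forall>x\<in>fps_over E. \<forall>y\<in>fps_over E. h' (T x) (T y) = h x y))"


section \<open>Matrices over an algebra and the modules defined by projections\<close>

text \<open>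
  The library's matrix operations require the type class \<open>semiring_1\<close> on the entries;
  here the multiplication is a parameter.
\<close>

definition mat_mul :: "('a::ab_group_add \<Rightarrow> 'a \<Rightarrow> 'a) \<Rightarrow> 'a ^ 'n ^ 'n \<Rightarrow> 'a ^ 'n ^ 'n \<Rightarrow> 'a ^ 'n ^ 'n"
  where "mat_mul mul K L = (\<chi> i j. \<Sum>k\<in>UNIV. mul (vec_nth (vec_nth K i) k) (vec_nth (vec_nth L k) j))"

definition mat_star :: "('a \<Rightarrow> 'a) \<Rightarrow> 'a ^ 'n ^ 'n \<Rightarrow> 'a ^ 'n ^ 'n"
  where "mat_star star L = (\<chi> i j. star (vec_nth (vec_nth L j) i))"

definition mat_vec :: "('a::ab_group_add \<Rightarrow> 'a \<Rightarrow> 'a) \<Rightarrow> 'a ^ 'n ^ 'n \<Rightarrow> 'a ^ 'n \<Rightarrow> 'a ^ 'n"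
  where "mat_vec mul L x = (\<chi> i. \<Sum>j\<in>UNIV. mul (vec_nth (vec_nth L i) j) (vec_nth x j))"

definition projection :: "('a::ab_group_add \<Rightarrow> 'a \<Rightarrow> 'a) \<Rightarrow> ('a \<Rightarrow> 'a) \<Rightarrow> 'a ^ 'n ^ 'n \<Rightarrow> bool"
  where "projection mul star P \<longleftrightarrow> P = mat_mul mul P P \<and> P = mat_star star P"

definition vec_scale :: "('c \<Rightarrow> 'a \<Rightarrow> 'a) \<Rightarrow> 'c \<Rightarrow> 'a ^ 'n \<Rightarrow> 'a ^ 'n"
  where "vec_scale scl c x = (\<chi> i. scl c (vec_nth x i))"

definition vec_act :: "('a \<Rightarrow> 'a \<Rightarrow> 'a) \<Rightarrow> 'a ^ 'n \<Rightarrow> 'a \<Rightarrow> 'a ^ 'n"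
  where "vec_act mul x a = (\<chi> i. mul (vec_nth x i) a)"

definition canonical_inner :: "('a::ab_group_add \<Rightarrow> 'a \<Rightarrow> 'a) \<Rightarrow> ('a \<Rightarrow> 'a) \<Rightarrow> 'a ^ 'n \<Rightarrow> 'a ^ 'n \<Rightarrow> 'a"
  where "canonical_inner mul star x y = (\<Sum>i\<in>UNIV. mul (star (vec_nth x i)) (vec_nth y i))"

definition projection_module :: "('a::ab_group_add \<Rightarrow> 'a \<Rightarrow> 'a) \<Rightarrow> 'a ^ 'n ^ 'n \<Rightarrow> ('a ^ 'n) set"
  where "projection_module mul P = range (mat_vec mul P)"


section \<open>Basic consequences\<close>

lemma bilin_UNIV_add:
  assumes "bilin_on s UNIV t UNIV u B"
  shows "B (x + y) z = B x z + B y z" and "B x (z + w) = B x z + B x w"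
    and "B (s c x) z = u c (B x z)" and "B x (t c z) = u c (B x z)"
  using assms by (auto simp: bilin_on_def lin_on_def)

context unital_algebra
begin

lemmas mul_add_left = bilin_UNIV_add(1)[OF mul_bilinear]
  and mul_add_right = bilin_UNIV_add(2)[OF mul_bilinear]
  and mul_scale_left = bilin_UNIV_add(3)[OF mul_bilinear]
  and mul_scale_right = bilin_UNIV_add(4)[OF mul_bilinear]

lemma mul_zero_left: "mul 0 a = 0"
  using mul_add_left[of 0 0 a] by simp

lemma mul_zero_right: "mul a 0 = 0"
  using mul_add_right[of a 0 0] by simp

lemma mul_sum_left: "mul (sum f I) a = (\<Sum>i\<in>I. mul (f i) a)"
  by (induction I rule: infinite_finite_induct) (simp_all add: mul_add_left mul_zero_left)

lemma mul_sum_right: "mul a (sum f I) = (\<Sum>i\<in>I. mul a (f i))"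
  by (induction I rule: infinite_finite_induct) (simp_all add: mul_add_right mul_zero_right)

lemma mat_vec_act: "mat_vec mul P (vec_act mul x a) = vec_act mul (mat_vec mul P x) a"
  by (simp add: mat_vec_def vec_act_def mul_sum_left mul_assoc)

lemma mat_vec_add: "mat_vec mul P (x + y) = mat_vec mul P x + mat_vec mul P y"
  by (simp add: mat_vec_def vec_eq_iff mul_add_right sum.distrib)

lemma mat_vec_scale: "mat_vec mul P (vec_scale scl c x) = vec_scale scl c (mat_vec mul P x)"
  by (simp add: mat_vec_def vec_scale_def vec_eq_iff mul_scale_right scale_sum_right)

lemma mat_vec_mul: "mat_vec mul P (mat_vec mul Q x) = mat_vec mul (mat_mul mul P Q) x"
proof -
  have "(\<Sum>j\<in>UNIV. \<Sum>k\<in>UNIV. mul (vec_nth (vec_nth P i) j) (mul (vec_nth (vec_nth Q j) k) (vec_nth x k)))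
      = (\<Sum>k\<in>UNIV. \<Sum>j\<in>UNIV. mul (vec_nth (vec_nth P i) j) (mul (vec_nth (vec_nth Q j) k) (vec_nth x k)))"
    for i
    by (rule sum.swap)
  then show ?thesis
    by (simp add: mat_vec_def mat_mul_def vec_eq_iff mul_sum_right mul_sum_left mul_assoc)
qed

lemma module_vec_scale: "module (vec_scale scl)"
  by standard (simp_all add: vec_scale_def vec_eq_iff scale_right_distrib scale_left_distrib)

lemma right_module_projection_module:
  fixes P :: "'a ^ 'n ^ 'n"
  shows "right_module scl mul one (vec_scale scl) (projection_module mul P) (vec_act mul)"
proof -
  interpret V: module "vec_scale scl :: 'c \<Rightarrow> 'a ^ 'n \<Rightarrow> 'a ^ 'n"
    by (rule module_vec_scale)
  have "mat_vec mul P 0 = 0"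
    using mat_vec_add[of P 0 0] by simp
  then have "V.subspace (projection_module mul P)"
    unfolding V.subspace_def projection_module_def
    by (auto simp flip: mat_vec_add mat_vec_scale intro: range_eqI[of _ _ 0])
  moreover have "vec_act mul x a \<in> projection_module mul P" if "x \<in> projection_module mul P" for x a
    using that by (auto simp: projection_module_def simp flip: mat_vec_act)
  ultimately show ?thesis
    by (auto simp: right_module_def V.module_axioms bilin_on_def lin_on_def vec_act_def vec_scale_def
        vec_eq_iff mul_add_left mul_add_right mul_scale_left mul_scale_right mul_assoc one_right)
qed

lemma fg_projective_projection_module:
  fixes P :: "'a ^ 'n ^ 'n"
  assumes P: "mat_mul mul P P = P"
  shows "fg_projective mul (projection_module mul P) (vec_act mul)"
proof -
  define m where "m = CARD('n)"
  obtain g :: "nat \<Rightarrow> 'n" where g: "bij_betw g {0..<m} UNIV"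
    using ex_bij_betw_nat_finite[of "UNIV :: 'n set"] by (auto simp: m_def)
  define f where "f = inv_into {0..<m} g"
  have f: "f j < m" "g (f j) = j" for j
    using g bij_betw_inv_into_right[OF g, of j] bij_betwE[OF bij_betw_inv_into[OF g]]
    by (auto simp: f_def)
  define \<iota> where "\<iota> = (\<lambda>(x :: 'a ^ 'n) i. if i < m then vec_nth x (g i) else 0)"
  define \<pi> where "\<pi> = (\<lambda>v :: nat \<Rightarrow> 'a. mat_vec mul P (\<chi> j. v (f j)))"
  have "mat_vec mul P x = x" if "x \<in> projection_module mul P" for x
    using that P by (auto simp: projection_module_def mat_vec_mul)
  moreover have "(\<chi> j. \<iota> x (f j)) = x" for x
    by (simp add: \<iota>_def f vec_eq_iff)
  ultimately have "\<pi> (\<iota> x) = x" if "x \<in> projection_module mul P" for x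
    using that by (simp add: \<pi>_def)
  moreover have "\<pi> (\<lambda>i. v i + w i) = \<pi> v + \<pi> w" for v w
    unfolding \<pi>_def by (simp flip: mat_vec_add) (simp add: plus_vec_def)
  moreover have "\<pi> (\<lambda>i. mul (v i) a) = vec_act mul (\<pi> v) a" for v a
    unfolding \<pi>_def by (simp flip: mat_vec_act) (simp add: vec_act_def)
  ultimately show ?thesis
    unfolding fg_projective_def Let_def
    by (intro exI[of _ m] exI[of _ \<iota>] exI[of _ \<pi>])
      (auto simp: \<iota>_def \<pi>_def projection_module_def vec_act_def fun_eq_iff mul_zero_left)
qed

end

context unital_star_algebra
begin

lemma star_zero: "star 0 = 0"
  using star_add[of 0 0] by simp

lemma star_sum: "star (sum f I) = (\<Sum>i\<in>I. star (f i))"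
  by (induction I rule: infinite_finite_induct) (simp_all add: star_add star_zero)

lemma cx_nonneg_sum: "(\<And>i. i \<in> I \<Longrightarrow> cx_nonneg (f i)) \<Longrightarrow> cx_nonneg (sum f I)"
  by (induction I rule: infinite_finite_induct)
    (auto simp: cx_nonneg_def zero_cx_def plus_cx_def)

lemma canonical_inner_positive: "canonical_inner mul star x x \<in> positive_elements scl mul star"
  by (auto simp: positive_elements_def positive_functional_def canonical_inner_def
      module_hom.sum intro!: cx_nonneg_sum)

text \<open>
  For the canonical inner product on \<open>P\<^sub>0 A\<^sup>n\<close>, nondegeneracy is the only condition in
  the definition of an inner-product module that does not hold automatically.
\<close>

lemma inner_product_module_iff:
  fixes P :: "'a ^ 'n ^ 'n"
  assumes "projection mul star P"
  shows "inner_product_module scl mul one star (vec_scale scl) (projection_module mul P)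
      (vec_act mul) (canonical_inner mul star) \<longleftrightarrow>
    (\<forall>x\<in>projection_module mul P. canonical_inner mul star x x = 0 \<longrightarrow> x = 0)"
proof -
  have P: "mat_mul mul P P = P"
    using assms by (simp add: projection_def)
  show ?thesis
    by (auto simp: inner_product_module_def inner_product_def right_module_projection_module
        fg_projective_projection_module[OF P] canonical_inner_positive[unfolded canonical_inner_def]
        canonical_inner_def star_sum star_mul star_star vec_act_def vec_scale_def mul_sum_left
        mul_assoc mul_add_right mul_scale_right sum.distrib scale_sum_right)
qed

end

lemma cx_nth_simps:
  "cx_nth (z + w) n = cx_nth z n + cx_nth w n"
  "cx_nth 1 n = (if n = 0 then 1 else 0)"
  "cx_nth (cx_cnj z) n = cx_cnj (cx_nth z n)"
  by (auto simp: cx_nth_def cx_cnj_def plus_cx_def one_cx_def zero_cx_def)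

lemma cx_sum: "sum f I = Cx (\<Sum>i\<in>I. cx_re (f i)) (\<Sum>i\<in>I. cx_im (f i))"
  by (induction I rule: infinite_finite_induct) (simp_all add: zero_cx_def plus_cx_def)

lemma cx_nth_mult: "cx_nth (z * w) n = (\<Sum>k\<le>n. cx_nth z k * cx_nth w (n - k))"
  by (simp add: cx_nth_def cx_sum times_cx_def fps_mult_nth atLeast0AtMost sum.distrib sum_subtractf)

lemma module_fps_scale:
  assumes "module scl"
  shows "module (fps_scale scl)"
proof -
  interpret module scl by fact
  have "fps_nth (fps_scale scl a (fps_scale scl b f)) n = fps_nth (fps_scale scl (a * b) f) n" for a b f n
  proof -
    have "fps_nth (fps_scale scl (a * b) f) n =
        (\<Sum>k\<le>n. \<Sum>i\<le>k. scl (cx_nth a i * cx_nth b (k - i)) (fps_nth f (n - k)))"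
      by (simp add: fps_scale_def cx_nth_mult scale_sum_left)
    also have "\<dots> = (\<Sum>k\<le>n. \<Sum>i\<le>k. (\<lambda>i j. scl (cx_nth a i * cx_nth b j) (fps_nth f (n - (i + j)))) i (k - i))"
      by (intro sum.cong refl) simp
    also have "\<dots> = (\<Sum>(i,j) | i + j \<le> n. scl (cx_nth a i * cx_nth b j) (fps_nth f (n - (i + j))))"
      by (rule sum.triangle_reindex_eq[symmetric])
    also have "\<dots> = (\<Sum>(i,j)\<in>(SIGMA i:{..n}. {..n - i}). scl (cx_nth a i * cx_nth b j) (fps_nth f (n - (i + j))))"
      by (intro sum.cong) auto
    also have "\<dots> = fps_nth (fps_scale scl a (fps_scale scl b f)) n"
      by (subst sum.Sigma[symmetric]) (auto simp: fps_scale_def scale_sum_right)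
    finally show ?thesis ..
  qed
  moreover have "fps_scale scl 1 f = f" for f
  proof (rule fps_ext)
    fix n
    have "fps_nth (fps_scale scl 1 f) n = (\<Sum>k\<le>n. if k = 0 then fps_nth f (n - k) else 0)"
      unfolding fps_scale_def fps_nth_Abs_fps by (intro sum.cong) (auto simp: cx_nth_simps)
    then show "fps_nth (fps_scale scl 1 f) n = fps_nth f n"
      by (simp add: sum.delta)
  qed
  ultimately show ?thesis
    by unfold_locales
      (auto simp: fps_eq_iff, auto simp: fps_scale_def cx_nth_simps scale_left_distrib
        scale_right_distrib sum.distrib)
qed

text \<open>A Hermitian deformation is again a star-algebra, now over \<open>R[[\<lambda>]](i)\<close>.\<close>

lemma hermitian_deformation_unital_star_algebra:
  assumes "unital_star_algebra scl mul one star" and "hermitian_deformation scl mul one star smul"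
  shows "unital_star_algebra (fps_scale scl) smul (fps_const one) (fps_star star)"
proof -
  interpret A: unital_star_algebra scl mul one star by fact
  interpret D: unital_algebra "fps_scale scl" smul "fps_const one"
    using assms(2) by (simp add: hermitian_deformation_def formal_deformation_def)
  show ?thesis
    by unfold_locales
      (use assms(2) in \<open>auto simp: hermitian_deformation_def fps_eq_iff fps_star_def fps_scale_def
        cx_nth_simps A.star_add A.star_scale A.star_star A.star_sum\<close>)
qed

end

theory Submission
  imports Defs
begin

text \<open>
  The matrices over the deformed algebra form a star-algebra that is complete for the
  \<open>\<lambda>\<close>-adic filtration, so \<open>P\<^sub>0\<close> lifts to a Hermitian idempotent \<open>P\<close>. As \<open>x \<mapsto> P x\<close> is the identity in
  order zero, it is a bijection from \<open>E[[\<lambda>]]\<close> onto the module \<open>M = P A[[\<lambda>]]\<^sup>n\<close>, and transporting the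
  structure of \<open>M\<close> along it gives a deformation.

  Conversely, in any deformation let \<open>e\<^sub>i\<close> be the columns of \<open>P\<^sub>0\<close>. The map \<open>y \<mapsto> \<Sum>\<^sub>i e\<^sub>i \<bullet> y\<^sub>i\<close> is an
  isomorphism from \<open>M\<close> onto it, again because it is the identity in order zero. It pulls the given
  inner product back to \<open>\<langle>x, H y\<rangle>\<close> for a Hermitian matrix \<open>H = P H P\<close> that agrees with \<open>P\<close> in order
  zero. Then \<open>G = H + 1 - P\<close> has a Hermitian inverse square root \<open>W\<close> commuting with \<open>P\<close>, and
  precomposition with \<open>W\<close> makes the isomorphism isometric. So every deformation is isometric to \<open>M\<close>.
\<close>

section \<open>Lifting projections and square roots in complete filtered star-algebras\<close>

context unital_algebra
begin

lemma mul_minus_left: "mul (- a) b = - mul a b"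
  using mul_add_left[of "- a" a b] by (simp add: mul_zero_left eq_neg_iff_add_eq_0)

lemma mul_minus_right: "mul a (- b) = - mul a b"
  using mul_add_right[of a "- b" b] by (simp add: mul_zero_right eq_neg_iff_add_eq_0)

lemma mul_diff_left: "mul (a - b) c = mul a c - mul b c"
  using mul_add_left[of a "- b" c] by (simp add: mul_minus_left)

lemma mul_diff_right: "mul a (b - c) = mul a b - mul a c"
  using mul_add_right[of a b "- c"] by (simp add: mul_minus_right)

lemmas mul_simps = mul_add_left mul_add_right mul_diff_left mul_diff_right
  mul_minus_left mul_minus_right mul_assoc one_left one_right mul_zero_left mul_zero_right

end

context unital_star_algebra
begin

lemma star_minus: "star (- a) = - star a"
  using star_add[of "- a" a] by (simp add: star_zero eq_neg_iff_add_eq_0)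

lemma star_diff: "star (a - b) = star a - star b"
  using star_add[of a "- b"] by (simp add: star_minus)

lemma star_one: "star one = one"
  by (metis one_left one_right star_mul star_star)

text \<open>The class supplies the rationals only through some embedding, so one half is chosen
  abstractly. Demanding that it be real makes scaling by it commute with the involution.\<close>

definition half :: "'r cx"
  where "half = (SOME z. z + z = 1 \<and> cx_cnj z = z)"

lemma half: "half + half = (1 :: 'r cx)" "cx_cnj half = (half :: 'r cx)"
proof -
  obtain \<iota> :: "rat \<Rightarrow> 'r" where \<iota>: "\<iota> 1 = 1" "\<And>p q. \<iota> (p + q) = \<iota> p + \<iota> q"
    using rat_embedding by blast
  have "\<iota> (1 / 2) + \<iota> (1 / 2) = 1"
    using \<iota>(2)[of "1 / 2" "1 / 2"] \<iota>(1) by simp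
  then have "\<exists>z :: 'r cx. z + z = 1 \<and> cx_cnj z = z"
    by (intro exI[of _ "Cx (\<iota> (1 / 2)) 0"]) (simp add: plus_cx_def one_cx_def cx_cnj_def)
  then have "half + half = (1 :: 'r cx) \<and> cx_cnj half = (half :: 'r cx)"
    unfolding half_def by (rule someI_ex)
  then show "half + half = (1 :: 'r cx)" "cx_cnj half = (half :: 'r cx)"
    by auto
qed

lemma scl_half_twice: "scl half a + scl half a = a"
  using scale_left_distrib[of half half a] by (simp add: half)

end

text \<open>\<open>I k\<close> plays the role of \<lambda>^k times the algebra; by
  \<open>I_0\<close> and \<open>I_mul\<close> it is a two-sided ideal. Completeness is asked of
  sequences that gain one order per step, a rate which the iterations below attain.\<close>

locale complete_star_algebra = unital_star_algebra scl mul one star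
  for scl :: "'r::rat_ordered_ring cx \<Rightarrow> 'a::ab_group_add \<Rightarrow> 'a" and mul one star +
  fixes I :: "nat \<Rightarrow> 'a set"
  assumes I_0: "I 0 = UNIV"
    and I_Suc: "I (Suc k) \<subseteq> I k"
    and I_subspace: "subspace (I k)"
    and I_mul: "a \<in> I j \<Longrightarrow> b \<in> I k \<Longrightarrow> mul a b \<in> I (j + k)"
    and I_star: "a \<in> I k \<Longrightarrow> star a \<in> I k"
    and I_separated: "(\<And>k. a \<in> I k) \<Longrightarrow> a = 0"
    and I_complete: "(\<And>k. s (Suc k) - s k \<in> I k) \<Longrightarrow> \<exists>l. \<forall>k. l - s k \<in> I k"
begin

lemma I_mono: "a \<in> I k \<Longrightarrow> j \<le> k \<Longrightarrow> a \<in> I j"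
  using lift_Suc_antimono_le[of I j k] I_Suc by blast

lemma I_add: "a \<in> I k \<Longrightarrow> b \<in> I k \<Longrightarrow> a + b \<in> I k"
  and I_diff: "a \<in> I k \<Longrightarrow> b \<in> I k \<Longrightarrow> a - b \<in> I k"
  and I_uminus: "a \<in> I k \<Longrightarrow> - a \<in> I k"
  and I_scale: "a \<in> I k \<Longrightarrow> scl c a \<in> I k"
  and I_zero: "0 \<in> I k"
  using I_subspace[of k] by (auto intro: subspace_add subspace_diff subspace_neg subspace_scale subspace_0)

lemma I_mul_left: "a \<in> I k \<Longrightarrow> mul a b \<in> I k"
  using I_mul[of a k b 0] by (simp add: I_0)

lemma I_mul_right: "b \<in> I k \<Longrightarrow> mul a b \<in> I k"
  using I_mul[of a 0 b k] by (simp add: I_0)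

text \<open>Congruence modulo a two-sided ideal is compatible with products. This is the continuity
  of the multiplication that carries algebraic identities over to limits.\<close>

lemma I_mul_diff: "mul a b - mul c d \<in> I k" if "a - c \<in> I k" "b - d \<in> I k"
proof -
  have "mul a b - mul c d = mul (a - c) b + mul c (b - d)"
    by (simp add: mul_simps)
  then show ?thesis
    using that by (auto intro: I_add I_mul_left I_mul_right)
qed

lemma I_trans: "a - b \<in> I k \<Longrightarrow> b - c \<in> I k \<Longrightarrow> a - c \<in> I k"
  using I_add[of "a - b" k "b - c"] by simp

lemma I_commute: "a - b \<in> I k \<Longrightarrow> b - a \<in> I k"
  using I_uminus[of "a - b" k] by simp

lemma eq_if_I: "(\<And>k. a - b \<in> I k) \<Longrightarrow> a = b"
  using I_separated[of "a - b"] by simp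

lemma star_limit:
  assumes "\<And>k. l - s k \<in> I k" and "\<And>k. star (s k) = s k"
  shows "star l = l"
proof (rule eq_if_I)
  fix k
  have "star l - s k \<in> I k"
    using I_star[OF assms(1)[of k]] by (simp add: star_diff assms(2))
  then show "star l - l \<in> I k"
    using I_commute[OF assms(1)[of k]] by (rule I_trans)
qed

text \<open>
  The iteration \<open>p \<mapsto> 3 p\<^sup>2 - 2 p\<^sup>3\<close>, which squares the error \<open>p\<^sup>2 - p\<close> up to a factor.
\<close>

lemma idempotent_step:
  assumes "mul p p - p \<in> I (Suc k)" and "star p = p"
  defines "d \<equiv> mul p p - p"
  defines "q \<equiv> p + (d - (mul p d + mul p d))"
  shows "mul q q - q \<in> I (Suc (Suc k))" and "star q = q" and "q - p \<in> I (Suc k)"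
proof -
  define e where "e = d - (mul p d + mul p d)"
  have d: "d \<in> I (Suc k)"
    using assms by simp
  then have e: "e \<in> I (Suc k)"
    unfolding e_def by (intro I_diff I_add I_mul_right)
  \<comment> \<open>Here \<open>e = (1 - 2 p) d\<close> and \<open>(1 - 2 p)^2 = 1 + 4 d\<close>, so
    the terms linear in \<open>d\<close> cancel and only quadratic ones remain.\<close>
  have "mul q q - q = mul e e - (mul d d + mul d d + mul d d + mul d d)"
    by (simp add: q_def e_def d_def mul_simps algebra_simps)
  moreover have "mul e e - (mul d d + mul d d + mul d d + mul d d) \<in> I (Suc k + Suc k)"
    using d e by (intro I_diff I_add I_mul)
  ultimately show "mul q q - q \<in> I (Suc (Suc k))"
    by (auto intro: I_mono)
  show "star q = q"
    by (simp add: q_def d_def star_add star_diff star_mul assms(2) mul_simps)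
  show "q - p \<in> I (Suc k)"
    using e by (simp add: q_def e_def)
qed

text \<open>The corrections lie in ever deeper \<open>I k\<close>, so the iterates converge;
  idempotency and self-adjointness pass to the limit because the filtration is separated.\<close>

lemma lift_projection:
  assumes "mul p p - p \<in> I 1" and "star p = p"
  obtains q where "mul q q = q" and "star q = q" and "q - p \<in> I 1"
proof -
  define s where "s = rec_nat p (\<lambda>_ p. p + ((mul p p - p) - (mul p (mul p p - p) + mul p (mul p p - p))))"
  have s: "mul (s k) (s k) - s k \<in> I (Suc k) \<and> star (s k) = s k" for k
  proof (induction k)
    case 0
    then show ?case
      using assms by (simp add: s_def)
  next
    case (Suc k)
    then show ?case
      using idempotent_step[of "s k" k] by (simp add: s_def)
  qed
  have s1: "s (Suc k) - s k \<in> I (Suc k)" for k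
    using idempotent_step(3)[of "s k" k] s[of k] by (simp add: s_def)
  obtain q where q: "\<And>k. q - s k \<in> I k"
    using I_complete[of s] s1 I_Suc by blast
  show thesis
  proof
    show "mul q q = q"
    proof (rule eq_if_I)
      fix k
      have "mul q q - mul (s k) (s k) \<in> I k"
        using q by (intro I_mul_diff)
      moreover have "mul (s k) (s k) - s k \<in> I k"
        using s I_Suc by blast
      ultimately show "mul q q - q \<in> I k"
        using I_commute[OF q[of k]] by (rule I_trans[OF I_trans])
    qed
    show "star q = q"
      using q by (rule star_limit) (use s in simp)
    \<comment> \<open>Convergence gives agreement of \<open>q\<close> with \<open>s 0 = p\<close>
      only modulo \<open>I 0\<close>, which is everything, so the comparison goes through
      \<open>s 1\<close>.\<close>
    show "q - p \<in> I 1"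
      using I_trans[OF q[of 1], of p] s1[of 0] by (simp add: s_def)
  qed
qed

text \<open>Adding \<open>c = d / 2\<close> to \<open>w\<close> changes \<open>w g w\<close> by
  \<open>c + c = d\<close> to leading order, since \<open>w\<close> and \<open>g\<close> are
  congruent to \<open>one\<close> modulo \<open>I 1\<close>. The error that is left either has an
  additional factor from \<open>I 1\<close> or is quadratic in \<open>c\<close>.\<close>

lemma inverse_sqrt_step:
  assumes "one - mul w (mul g w) \<in> I (Suc k)" and "w - one \<in> I 1" and "g - one \<in> I 1"
  defines "d \<equiv> one - mul w (mul g w)"
  defines "v \<equiv> w + scl half d"
  shows "one - mul v (mul g v) \<in> I (Suc (Suc k))" and "v - one \<in> I 1" and "v - w \<in> I (Suc k)"
proof -
  define c where "c = scl half d"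
  have c: "c \<in> I (Suc k)" "d = c + c"
    using assms by (auto simp: c_def scl_half_twice intro: I_scale)
  have gw: "one - mul g w \<in> I 1" "one - mul w g \<in> I 1"
    using I_mul_diff[of g one 1 w one] I_mul_diff[of w one 1 g one] assms(2,3)
    by (auto simp: one_left intro: I_commute)
  have v: "v = w + c"
    by (simp add: v_def c_def)
  have "one - mul v (mul g v) = d - (mul c (mul g w) + mul w (mul g c) + mul c (mul g c))"
    by (simp add: v d_def mul_simps algebra_simps)
  also have "\<dots> = mul c (one - mul g w) + mul (one - mul w g) c - mul c (mul g c)"
    by (simp add: c(2) mul_simps algebra_simps)
  also have "\<dots> \<in> I (Suc (Suc k))"
  proof (intro I_diff I_add)
    show "mul c (one - mul g w) \<in> I (Suc (Suc k))" "mul (one - mul w g) c \<in> I (Suc (Suc k))"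
      using I_mul[OF c(1) gw(1)] I_mul[OF gw(2) c(1)] by simp_all
    show "mul c (mul g c) \<in> I (Suc (Suc k))"
      using I_mul[OF c(1) I_mul_right[OF c(1), of g]] by (auto intro: I_mono)
  qed
  finally show "one - mul v (mul g v) \<in> I (Suc (Suc k))" .
  show vw: "v - w \<in> I (Suc k)"
    using c by (simp add: v)
  show "v - one \<in> I 1"
    using I_trans[OF I_mono[OF vw] assms(2)] by simp
qed

text \<open>The iteration starts at \<open>one\<close>, so every iterate is a polynomial in
  \<open>g\<close> with real coefficients. It is therefore Hermitian and commutes with whatever
  commutes with \<open>g\<close>, and the limit inherits both properties.\<close>

lemma inverse_sqrt:
  assumes g: "g - one \<in> I 1" and star_g: "star g = g" and p: "mul p g = mul g p"
  obtains w where "mul w (mul g w) = one" and "star w = w" and "mul p w = mul w p" and "w - one \<in> I 1"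
proof -
  define s where "s = rec_nat one (\<lambda>_ w. w + scl half (one - mul w (mul g w)))"
  have s0: "s 0 = one" and sS: "s (Suc k) = s k + scl half (one - mul (s k) (mul g (s k)))" for k
    by (simp_all add: s_def)
  have s: "one - mul (s k) (mul g (s k)) \<in> I (Suc k) \<and> s k - one \<in> I 1" for k
  proof (induction k)
    case 0
    then show ?case
      using I_commute[OF g] by (simp add: s0 mul_simps I_zero)
  next
    case (Suc k)
    then show ?case
      using inverse_sqrt_step(1,2)[of "s k" g k] g by (simp add: sS)
  qed
  have s1: "s (Suc k) - s k \<in> I (Suc k)" for k
    using inverse_sqrt_step(3)[of "s k" g k] s[of k] g by (simp add: sS)
  have s_star: "star (s k) = s k" for k
    by (induction k) (simp_all add: s0 sS star_one star_add star_scale half star_diff star_mul star_g mul_assoc)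
  have s_comm: "mul p (s k) = mul (s k) p" for k
  proof (induction k)
    case 0
    then show ?case
      by (simp add: s0 mul_simps)
  next
    case (Suc k)
    have "mul p (mul (s k) (mul g (s k))) = mul (s k) (mul g (mul (s k) p))"
      by (metis Suc p mul_assoc)
    then show ?case
      using Suc by (simp add: sS mul_simps mul_scale_left mul_scale_right)
  qed
  obtain w where w: "\<And>k. w - s k \<in> I k"
    using I_complete[of s] s1 I_Suc by blast
  show thesis
  proof
    show "mul w (mul g w) = one"
    proof (rule eq_if_I)
      fix k
      have "mul w (mul g w) - mul (s k) (mul g (s k)) \<in> I k"
        using w by (intro I_mul_diff) (simp_all add: I_zero)
      moreover have "mul (s k) (mul g (s k)) - one \<in> I k"
        using s I_Suc I_commute by blast
      ultimately show "mul w (mul g w) - one \<in> I k"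
        by (rule I_trans)
    qed
    show "star w = w"
      using w s_star by (rule star_limit)
    show "mul p w = mul w p"
    proof (rule eq_if_I)
      fix k
      have "mul p w - mul p (s k) \<in> I k" "mul (s k) p - mul w p \<in> I k"
        using w I_commute[OF w] by (auto intro!: I_mul_diff simp: I_zero)
      then show "mul p w - mul w p \<in> I k"
        using I_trans[of "mul p w" "mul p (s k)" k "mul w p"] by (simp add: s_comm)
    qed
    show "w - one \<in> I 1"
      using I_trans[OF w[of 1]] s[of 1] by simp
  qed
qed

end


section \<open>Matrices over a star-algebra\<close>

definition mat_one :: "'a::zero \<Rightarrow> 'a ^ 'n ^ 'n"
  where "mat_one one = (\<chi> i j. if i = j then one else 0)"

text \<open>In this orientation the two equations terminate as rewrite rules.\<close>

lemma projection_conv: "projection mul star P \<longleftrightarrow> mat_mul mul P P = P \<and> mat_star star P = P"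
  unfolding projection_def by (simp add: eq_commute)

context unital_algebra
begin

lemma mat_vec_add_left: "mat_vec mul (P + Q) x = mat_vec mul P x + mat_vec mul Q x"
  by (simp add: mat_vec_def vec_eq_iff mul_add_left sum.distrib)

lemma mat_vec_diff_left: "mat_vec mul (P - Q) x = mat_vec mul P x - mat_vec mul Q x"
  by (simp add: mat_vec_def vec_eq_iff mul_diff_left sum_subtractf)

lemma mat_vec_one: "mat_vec mul (mat_one one) x = x"
  by (simp add: mat_vec_def mat_one_def vec_eq_iff if_distrib[of "\<lambda>a. mul a _"] one_left
      mul_zero_left cong: if_cong)

lemma mat_vec_axis: "mat_vec mul P (axis j one) = (\<chi> i. P $ i $ j)"
  by (simp add: mat_vec_def axis_def vec_eq_iff if_distrib[of "mul _"] one_right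
      mul_zero_right cong: if_cong)

text \<open>The columns of \<open>P\<close>, written as images of the standard basis, generate the
  projection module. This serves both for \<open>P\<^sub>0\<close> and for its lift.\<close>

lemma mat_vec_conv_columns: "mat_vec mul P x = (\<Sum>i\<in>UNIV. vec_act mul (mat_vec mul P (axis i one)) (x $ i))"
  unfolding mat_vec_axis by (simp add: vec_eq_iff mat_vec_def vec_act_def)

lemma mat_mul_one_left: "mat_mul mul (mat_one one) L = L"
  by (simp add: mat_mul_def mat_one_def vec_eq_iff if_distrib[of "\<lambda>a. mul a _"] one_left
      mul_zero_left cong: if_cong)

lemma mat_mul_one_right: "mat_mul mul L (mat_one one) = L"
  by (simp add: mat_mul_def mat_one_def vec_eq_iff if_distrib[of "mul _"] one_right
      mul_zero_right cong: if_cong)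

lemma mat_mul_assoc: "mat_mul mul (mat_mul mul K L) N = mat_mul mul K (mat_mul mul L N)"
proof -
  have "(\<Sum>k\<in>UNIV. \<Sum>l\<in>UNIV. mul (K $ i $ l) (mul (L $ l $ k) (N $ k $ j)))
      = (\<Sum>l\<in>UNIV. \<Sum>k\<in>UNIV. mul (K $ i $ l) (mul (L $ l $ k) (N $ k $ j)))" for i j
    by (rule sum.swap)
  then show ?thesis
    by (simp add: mat_mul_def vec_eq_iff mul_sum_left mul_sum_right mul_assoc)
qed

end

context unital_star_algebra
begin

lemma unital_star_algebra_matrix:
  "unital_star_algebra (vec_scale (vec_scale scl)) (mat_mul mul)
    (mat_one one :: 'a ^ 'n ^ 'n) (mat_star star)"
  by unfold_locales
    (simp_all add: mat_mul_assoc mat_mul_one_left mat_mul_one_right bilin_on_def lin_on_def,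
      simp_all add: vec_eq_iff vec_scale_def mat_mul_def mat_star_def scale_right_distrib
      scale_left_distrib mul_add_left mul_add_right mul_scale_left mul_scale_right sum.distrib
      scale_sum_right star_add star_scale star_mul star_star star_sum)

lemma canonical_inner_mat_vec:
  "canonical_inner mul star (mat_vec mul L x) y = canonical_inner mul star x (mat_vec mul (mat_star star L) y)"
proof -
  have "(\<Sum>i\<in>UNIV. \<Sum>j\<in>UNIV. mul (star (x $ j)) (mul (star (L $ i $ j)) (y $ i)))
      = (\<Sum>j\<in>UNIV. \<Sum>i\<in>UNIV. mul (star (x $ j)) (mul (star (L $ i $ j)) (y $ i)))"
    by (rule sum.swap)
  then show ?thesis
    by (simp add: canonical_inner_def mat_vec_def mat_star_def star_sum star_mul
        mul_sum_left mul_sum_right mul_assoc)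
qed

end


section \<open>Power series and the deformation parameter\<close>

text \<open>The scalar \<lambda>^k as an element of \<open>R[[\<lambda>]](i)\<close>.\<close>

definition cx_lam :: "nat \<Rightarrow> 'r::comm_ring_1 fps cx"
  where "cx_lam k = Cx (fps_X ^ k) 0"

definition cx_const :: "'r::zero cx \<Rightarrow> 'r fps cx"
  where "cx_const c = Cx (fps_const (cx_re c)) (fps_const (cx_im c))"

lemma cx_nth_lam: "cx_nth (cx_lam k) j = (if j = k then 1 else 0)"
  by (simp add: cx_nth_def cx_lam_def fps_X_power_nth zero_cx_def one_cx_def)

lemma cx_nth_const: "cx_nth (cx_const c) j = (if j = 0 then c else 0)"
  by (cases c) (simp add: cx_nth_def cx_const_def zero_cx_def)

lemma cx_cnj_lam: "cx_cnj (cx_lam k) = cx_lam k"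
  by (simp add: cx_cnj_def cx_lam_def)

lemma cx_lam_mult: "cx_lam j * cx_lam k = cx_lam (j + k)"
  by (simp add: cx_lam_def times_cx_def power_add)

lemma fps_over_UNIV [simp]: "fps_over UNIV = UNIV"
  by (simp add: fps_over_def)

lemma fps_const_in_fps_over: "x \<in> E \<Longrightarrow> 0 \<in> E \<Longrightarrow> fps_const x \<in> fps_over E"
  by (simp add: fps_over_def)

lemma fps_shift_in_fps_over: "x \<in> fps_over E \<Longrightarrow> fps_shift k x \<in> fps_over E"
  by (simp add: fps_over_def)

locale cx_module = module scale
  for scale :: "'r::comm_ring_1 cx \<Rightarrow> 'e::ab_group_add \<Rightarrow> 'e"
begin

lemma module_fps: "module (fps_scale scale)"
  by (rule module_fps_scale) (rule module_axioms)

lemma fps_nth_scale_lam: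
  "fps_nth (fps_scale scale (cx_lam k) f) n = (if n < k then 0 else fps_nth f (n - k))"
proof -
  have "fps_nth (fps_scale scale (cx_lam k) f) n = (\<Sum>i\<le>n. if i = k then fps_nth f (n - i) else 0)"
    unfolding fps_scale_def fps_nth_Abs_fps by (intro sum.cong) (auto simp: cx_nth_lam)
  then show ?thesis
    by (simp add: sum.delta)
qed

lemma fps_nth_scale_const: "fps_nth (fps_scale scale (cx_const c) f) n = scale c (fps_nth f n)"
proof -
  have "fps_nth (fps_scale scale (cx_const c) f) n = (\<Sum>i\<le>n. if i = 0 then scale c (fps_nth f (n - i)) else 0)"
    unfolding fps_scale_def fps_nth_Abs_fps by (intro sum.cong) (auto simp: cx_nth_const)
  then show ?thesis
    by (simp add: sum.delta)
qed

lemma fps_const_scale: "fps_const (scale c x) = fps_scale scale (cx_const c) (fps_const x)"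
  by (simp add: fps_eq_iff fps_nth_scale_const)

lemma fps_eq_scale_lam_shift:
  assumes "\<And>n. n < k \<Longrightarrow> fps_nth f n = 0"
  shows "f = fps_scale scale (cx_lam k) (fps_shift k f)"
  using assms by (auto simp: fps_eq_iff fps_nth_scale_lam)

lemma fps_eq_const_plus_lam:
  "f = fps_const (fps_nth f 0) + fps_scale scale (cx_lam 1) (fps_shift 1 f)"
  by (auto simp: fps_eq_iff fps_nth_scale_lam)

lemma subspace_fps_over:
  assumes "subspace E"
  shows "module.subspace (fps_scale scale) (fps_over E)"
proof -
  interpret F: module "fps_scale scale"
    by (rule module_fps)
  show ?thesis
    unfolding F.subspace_def using assms
    by (auto simp: fps_over_def fps_scale_def subspace_0 subspace_add intro!: subspace_sum subspace_scale)
qed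

text \<open>Write \<open>x\<close> as its constant term plus \<lambda> times a series: linearity
  over the power series scalars keeps the second part out of order zero. The components of actions
  and of equivalences are obtained as such coefficients on constant series.\<close>

lemma lin_on_fps_coefficient:
  assumes "cx_module t" and E: "subspace E" and L: "lin_on (fps_scale scale) (fps_over E) (fps_scale t) L"
  shows "lin_on scale E t (\<lambda>x. fps_nth (L (fps_const x)) r)"
    and "x \<in> fps_over E \<Longrightarrow> fps_nth (L x) 0 = fps_nth (L (fps_const (fps_nth x 0))) 0"
proof -
  interpret t: cx_module t by fact
  interpret F: module "fps_scale scale"
    by (rule module_fps)
  have const: "fps_const x \<in> fps_over E" if "x \<in> E" for x
    using that E by (intro fps_const_in_fps_over subspace_0)
  show "lin_on scale E t (\<lambda>x. fps_nth (L (fps_const x)) r)"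
    using L const by (simp add: lin_on_def fps_const_scale t.fps_nth_scale_const flip: fps_const_add)
  assume x: "x \<in> fps_over E"
  define y where "y = fps_shift 1 x"
  have y: "y \<in> fps_over E" "fps_scale scale (cx_lam 1) y \<in> fps_over E"
    using x F.subspace_scale[OF subspace_fps_over[OF E]] by (auto simp: y_def fps_shift_in_fps_over)
  have "fps_const (fps_nth x 0) \<in> fps_over E"
    using x by (intro const) (simp add: fps_over_def)
  then have "L (fps_const (fps_nth x 0) + fps_scale scale (cx_lam 1) y)
      = L (fps_const (fps_nth x 0)) + fps_scale t (cx_lam 1) (L y)"
    using L y by (simp add: lin_on_def)
  moreover have "fps_const (fps_nth x 0) + fps_scale scale (cx_lam 1) y = x"
    unfolding y_def by (rule fps_eq_const_plus_lam[symmetric])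
  ultimately have "L x = L (fps_const (fps_nth x 0)) + fps_scale t (cx_lam 1) (L y)"
    by simp
  then show "fps_nth (L x) 0 = fps_nth (L (fps_const (fps_nth x 0))) 0"
    by (simp add: t.fps_nth_scale_lam)
qed

text \<open>
  A preimage is built one coefficient at a time, as the remainder \<open>y - L y\<^sub>0\<close> is divisible by \<open>\<lambda>\<close>.
\<close>

lemma bij_betw_fps_over_if_unipotent:
  assumes E: "subspace E"
    and Y: "module.subspace (fps_scale scale) Y"
    and Y_sat: "\<And>y. fps_scale scale (cx_lam 1) y \<in> Y \<Longrightarrow> y \<in> Y"
    and Y_0: "\<And>y. y \<in> Y \<Longrightarrow> fps_nth y 0 \<in> E"
    and L: "lin_on (fps_scale scale) (fps_over E) (fps_scale scale) L"
    and L_Y: "\<And>x. x \<in> fps_over E \<Longrightarrow> L x \<in> Y"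
    and L_0: "\<And>x. x \<in> fps_over E \<Longrightarrow> fps_nth (L x) 0 = fps_nth x 0"
  shows "bij_betw L (fps_over E) Y"
proof -
  interpret F: module "fps_scale scale"
    by (rule module_fps)
  note EE = subspace_fps_over[OF E]
  have L_add: "L (x + y) = L x + L y" if "x \<in> fps_over E" "y \<in> fps_over E" for x y
    using L that by (simp add: lin_on_def)
  have L_lam: "L (fps_scale scale (cx_lam k) x) = fps_scale scale (cx_lam k) (L x)" if "x \<in> fps_over E" for x k
    using L that by (simp add: lin_on_def)
  have ker: "x = 0" if x: "x \<in> fps_over E" and "L x = 0" for x
  proof -
    \<comment> \<open>If \<open>x\<close> vanishes below order \<open>n\<close>, it is \<lambda>^n
      times its shift. The coefficient of \<open>L x\<close> at \<open>n\<close> is then the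
      constant term of the shift, that is, the coefficient of \<open>x\<close> at
      \<open>n\<close>.\<close>
    have "fps_nth x n = 0" for n
    proof (induction n rule: less_induct)
      case (less n)
      have eq: "x = fps_scale scale (cx_lam n) (fps_shift n x)"
        using less by (rule fps_eq_scale_lam_shift)
      have sx: "fps_shift n x \<in> fps_over E"
        using x by (rule fps_shift_in_fps_over)
      have "fps_nth (L x) n = fps_nth (L (fps_shift n x)) 0"
        by (subst eq) (simp add: L_lam[OF sx] fps_nth_scale_lam)
      then show ?case
        using L_0[OF sx] \<open>L x = 0\<close> by simp
    qed
    then show ?thesis
      by (simp add: fps_eq_iff)
  qed
  have "inj_on L (fps_over E)"
  proof (rule inj_onI)
    fix x y assume xy: "x \<in> fps_over E" "y \<in> fps_over E" "L x = L y"
    then have d: "x - y \<in> fps_over E"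
      using F.subspace_diff[OF EE] by blast
    have "L (x - y) + L y = L x"
      using L_add[OF d xy(2)] by simp
    then show "x = y"
      using ker[OF d] xy(3) by simp
  qed
  moreover have "\<exists>x\<in>fps_over E. L x = y" if y: "y \<in> Y" for y
  proof -
    \<comment> \<open>\<open>r k\<close> is what remains of \<open>y\<close> after the image of the
      first \<open>k\<close> terms of the preimage is subtracted, divided by \<lambda>^k.\<close>
    define r where "r = rec_nat y (\<lambda>_ z. fps_shift 1 (z - L (fps_const (fps_nth z 0))))"
    have r0: "r 0 = y" and rS: "r (Suc k) = fps_shift 1 (r k - L (fps_const (fps_nth (r k) 0)))" for k
      by (simp_all add: r_def)
    have const: "fps_const x \<in> fps_over E" if "x \<in> E" for x
      using that E by (intro fps_const_in_fps_over subspace_0)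
    have r_eq: "r k - L (fps_const (fps_nth (r k) 0)) = fps_scale scale (cx_lam 1) (r (Suc k))"
      if "r k \<in> Y" for k
      unfolding rS using L_0[OF const[OF Y_0[OF that]]]
      by (intro fps_eq_scale_lam_shift) simp
    have rY: "r k \<in> Y" for k
    proof (induction k)
      case 0
      then show ?case
        using y by (simp add: r0)
    next
      case (Suc k)
      \<comment> \<open>The remainder before division lies in \<open>Y\<close> and equals \<lambda>
        times \<open>r (Suc k)\<close>, so saturation of \<open>Y\<close> applies.\<close>
      show ?case
        using F.subspace_diff[OF Y Suc L_Y[OF const[OF Y_0[OF Suc]]]]
        by (rule Y_sat[OF back_subst[where P = "\<lambda>z. z \<in> Y", OF _ r_eq[OF Suc]]])
    qed
    define x where "x = Abs_fps (\<lambda>k. fps_nth (r k) 0)"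
    have x: "x \<in> fps_over E"
      using rY Y_0 by (auto simp: x_def fps_over_def)
    \<comment> \<open>With the whole series \<open>x\<close> in place of its partial sums, the
      coefficient of \<open>y - L x\<close> at \<open>k\<close> becomes a difference of two constant
      terms, which agree by the choice of \<open>x\<close>.\<close>
    have rem: "y - L x = fps_scale scale (cx_lam k) (r k - L (fps_shift k x))" for k
    proof (induction k)
      case 0
      show ?case
        by (auto simp: r0 fps_eq_iff fps_nth_scale_lam)
    next
      case (Suc k)
      have sx: "fps_shift (Suc k) x \<in> fps_over E"
        using x by (rule fps_shift_in_fps_over)
      have "fps_shift k x = fps_const (fps_nth (r k) 0) + fps_scale scale (cx_lam 1) (fps_shift (Suc k) x)"
        by (auto simp: fps_eq_iff fps_nth_scale_lam x_def)
      then have "L (fps_shift k x) = L (fps_const (fps_nth (r k) 0)) + fps_scale scale (cx_lam 1) (L (fps_shift (Suc k) x))"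
        using L_lam[OF sx] L_add[OF const[OF Y_0[OF rY]] F.subspace_scale[OF EE sx]] by simp
      then have "r k - L (fps_shift k x) = fps_scale scale (cx_lam 1) (r (Suc k) - L (fps_shift (Suc k) x))"
        using r_eq[OF rY[of k]] by (simp add: F.scale_right_diff_distrib algebra_simps)
      then show ?case
        using Suc by (simp add: cx_lam_mult)
    qed
    have "fps_nth (y - L x) k = 0" for k
    proof -
      have "fps_nth (y - L x) k = fps_nth (r k - L (fps_shift k x)) 0"
        by (subst rem[of k]) (simp add: fps_nth_scale_lam)
      then show ?thesis
        using L_0[OF fps_shift_in_fps_over[OF x]] by (simp add: x_def)
    qed
    then have "L x = y"
      by (simp add: fps_eq_iff)
    with x show ?thesis
      by blast
  qed
  ultimately show ?thesis
    using L_Y by (auto simp: bij_betw_def)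
qed

end


section \<open>Isometric isomorphisms of modules\<close>

lemma lin_on_inv_into:
  assumes "module s" and E: "module.subspace s E" and f: "lin_on s E t f" and bij: "bij_betw f E F"
  shows "lin_on t F s (inv_into E f)"
proof -
  interpret module s by fact
  have inv: "inv_into E f (f x) = x" if "x \<in> E" for x
    using that bij by (simp add: bij_betw_def)
  have "F = f ` E"
    using bij by (simp add: bij_betw_def)
  moreover have "inv_into E f (f x + f y) = x + y" "inv_into E f (t c (f x)) = s c x"
    if "x \<in> E" "y \<in> E" for x y c
    using f that inv[OF subspace_add[OF E that]] inv[OF subspace_scale[OF E that(1)]]
    by (simp_all add: lin_on_def)
  ultimately show ?thesis
    by (auto simp: lin_on_def inv)
qed

lemma right_module_transport:
  assumes F: "right_module scl mul one t F act" and "module s" and E: "module.subspace s E"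
    and J: "lin_on s E t J" and bij: "bij_betw J E F"
  shows "right_module scl mul one s E (\<lambda>x a. inv_into E J (act (J x) a))"
proof -
  interpret module s by fact
  have JF: "J x \<in> F" if "x \<in> E" for x
    using that bij by (auto simp: bij_betw_def)
  have actF: "act y a \<in> F" if "y \<in> F" for y a
    using that F by (simp add: right_module_def)
  have K: "inv_into E J y \<in> E" "J (inv_into E J y) = y" if "y \<in> F" for y
    using that bij by (auto simp: bij_betw_def inv_into_into f_inv_into_f)
  have KJ: "inv_into E J (J x) = x" if "x \<in> E" for x
    using that bij by (simp add: bij_betw_def)
  have lin: "lin_on t F s (inv_into E J)"
    using assms(2-5) by (rule lin_on_inv_into)
  show ?thesis
    using F lin J E
    by (auto simp: right_module_def module_axioms bilin_on_def lin_on_def actF JF K KJ)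
qed

lemma inner_product_transport:
  assumes F: "inner_product scl mul star t F act h" and "module s" and E: "module.subspace s E"
    and act_F: "\<And>y a. y \<in> F \<Longrightarrow> act y a \<in> F"
    and J: "lin_on s E t J" and bij: "bij_betw J E F"
  shows "inner_product scl mul star s E (\<lambda>x a. inv_into E J (act (J x) a)) (\<lambda>x y. h (J x) (J y))"
proof -
  interpret module s by fact
  have JF: "J x \<in> F" if "x \<in> E" for x
    using that bij by (auto simp: bij_betw_def)
  have K: "J (inv_into E J y) = y" if "y \<in> F" for y
    using that bij by (auto simp: bij_betw_def inv_into_into f_inv_into_f)
  have inj: "x = y" if "x \<in> E" "y \<in> E" "J x = J y" for x y
    using that bij by (auto simp: bij_betw_def dest: inj_onD)
  have J_comb: "J (s c x + s d y) = t c (J x) + t d (J y)" if "x \<in> E" "y \<in> E" for x y c d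
    using J that subspace_scale[OF E] by (simp add: lin_on_def)
  have J0: "J 0 = 0"
    using J subspace_0[OF E] by (simp add: lin_on_def) (metis add_cancel_right_right)
  have "x = 0" if "x \<in> E" "h (J x) (J x) = 0" for x
    using F that JF[OF that(1)] inj[OF that(1) subspace_0[OF E]] by (simp add: inner_product_def J0)
  then show ?thesis
    using F by (simp add: inner_product_def J_comb JF K act_F)
qed

text \<open>An equivalence of deformations without the condition in order zero, and between possibly
  different modules, so that deformations can be compared through a common model.\<close>

definition isometry_on :: "('c \<Rightarrow> 'x \<Rightarrow> 'x) \<Rightarrow> 'x set \<Rightarrow> ('x \<Rightarrow> 'a \<Rightarrow> 'x) \<Rightarrow> ('x \<Rightarrow> 'x \<Rightarrow> 'a) \<Rightarrow>
    ('c \<Rightarrow> 'y \<Rightarrow> 'y) \<Rightarrow> 'y set \<Rightarrow> ('y \<Rightarrow> 'a \<Rightarrow> 'y) \<Rightarrow> ('y \<Rightarrow> 'y \<Rightarrow> 'a) \<Rightarrow>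
    ('x::ab_group_add \<Rightarrow> 'y::ab_group_add) \<Rightarrow> bool"
  where "isometry_on s E act h s' F act' h' f \<longleftrightarrow>
    lin_on s E s' f \<and> bij_betw f E F \<and> (\<forall>x\<in>E. \<forall>a. f (act x a) = act' (f x) a) \<and>
    (\<forall>x\<in>E. \<forall>y\<in>E. h' (f x) (f y) = h x y)"

lemma isometry_on_compose:
  assumes "isometry_on s E act h s' F act' h' f" and "isometry_on s' F act' h' s'' G act'' h'' g"
  shows "isometry_on s E act h s'' G act'' h'' (g \<circ> f)"
proof -
  have "f x \<in> F" if "x \<in> E" for x
    using that assms(1) by (auto simp: isometry_on_def bij_betw_def)
  then show ?thesis
    using assms bij_betw_trans[of f E F g G] by (auto simp: isometry_on_def lin_on_def)
qed

lemma isometry_on_inv_into: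
  assumes f: "isometry_on s E act h s' F act' h' f" and "right_module scl mul one s E act"
  shows "isometry_on s' F act' h' s E act h (inv_into E f)"
proof -
  have E: "module s" "module.subspace s E" and act: "\<And>x a. x \<in> E \<Longrightarrow> act x a \<in> E"
    using assms(2) by (auto simp: right_module_def)
  have bij: "bij_betw f E F" and F: "F = f ` E" and lin: "lin_on s E s' f"
    using f by (auto simp: isometry_on_def bij_betw_def)
  have inv: "inv_into E f (f x) = x" if "x \<in> E" for x
    using that bij by (simp add: bij_betw_def)
  have "inv_into E f (act' y a) = act (inv_into E f y) a" if "y \<in> F" for y a
  proof -
    obtain x where x: "x \<in> E" "y = f x"
      using \<open>y \<in> F\<close> F by auto
    then have "act' y a = f (act x a)"
      using f by (simp add: isometry_on_def)
    then show ?thesis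
      using x act by (simp add: inv)
  qed
  moreover have "h (inv_into E f y) (inv_into E f z) = h' y z" if "y \<in> F" "z \<in> F" for y z
    using that f F inv by (auto simp: isometry_on_def)
  ultimately show ?thesis
    using lin_on_inv_into[OF E lin bij] bij_betw_inv_into[OF bij] by (simp add: isometry_on_def)
qed

text \<open>The components of \<open>T\<close> are its coefficients on constant series; that they
  are linear and map \<open>E\<close> to itself follows from the corresponding properties of
  \<open>T\<close>.\<close>

lemma equivalent_deformationsI:
  fixes T :: "'e::ab_group_add fps \<Rightarrow> 'e fps"
  assumes "module sE" and E: "module.subspace sE E"
    and T: "isometry_on (fps_scale sE) (fps_over E) bact h (fps_scale sE) (fps_over E) bact' h' T"
    and T_0: "\<And>x. x \<in> E \<Longrightarrow> fps_nth (T (fps_const x)) 0 = x"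
  shows "equivalent_deformations sE E bact h bact' h'"
proof -
  interpret module sE by fact
  interpret cx_module sE ..
  have "fps_const x \<in> fps_over E" if "x \<in> E" for x
    using that E by (intro fps_const_in_fps_over subspace_0)
  then have "T (fps_const x) \<in> fps_over E" if "x \<in> E" for x
    using T that by (auto simp: isometry_on_def bij_betw_def)
  then have "fps_nth (T (fps_const x)) r \<in> E" if "x \<in> E" for x r
    using that by (simp add: fps_over_def)
  moreover have "lin_on sE E sE (\<lambda>x. fps_nth (T (fps_const x)) r)" for r
    using T by (intro lin_on_fps_coefficient cx_module_axioms E) (simp add: isometry_on_def)
  ultimately show ?thesis
    unfolding equivalent_deformations_def using T T_0
    by (intro exI[of _ T] exI[of _ "\<lambda>r x. fps_nth (T (fps_const x)) r"])
      (simp add: isometry_on_def fps_nth_inverse)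
qed

section \<open>Matrices over a Hermitian deformation\<close>

text \<open>The matrices divisible by \<lambda>^k, the \<lambda>-adic filtration of the matrix
  algebra.\<close>

definition mat_fps_ideal :: "nat \<Rightarrow> ('a::zero fps ^ 'n ^ 'n) set"
  where "mat_fps_ideal k = {L. \<forall>i j. \<forall>n<k. fps_nth (L $ i $ j) n = 0}"

definition vec_fps_nth :: "nat \<Rightarrow> 'a fps ^ 'n \<Rightarrow> 'a ^ 'n"
  where "vec_fps_nth n x = (\<chi> i. fps_nth (x $ i) n)"

locale deformed_algebra = unital_star_algebra scl mul one star
  for scl :: "'r::rat_ordered_ring cx \<Rightarrow> 'a::ab_group_add \<Rightarrow> 'a" and mul one star +
  fixes smul :: "'a fps \<Rightarrow> 'a fps \<Rightarrow> 'a fps"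
  assumes deformation: "hermitian_deformation scl mul one star smul"
begin

sublocale D: unital_star_algebra "fps_scale scl" smul "fps_const one" "fps_star star"
  by (rule hermitian_deformation_unital_star_algebra) (rule unital_star_algebra_axioms deformation)+

sublocale cx_module scl ..

text \<open>Linearity in each argument reduces order zero of a product to constant series, where it
  is the undeformed product.\<close>

lemma smul_nth_0: "fps_nth (smul f g) 0 = mul (fps_nth f 0) (fps_nth g 0)"
proof -
  have "lin_on (fps_scale scl) (fps_over UNIV) (fps_scale scl) (smul f)"
    "lin_on (fps_scale scl) (fps_over UNIV) (fps_scale scl) (\<lambda>f. smul f g)" for f g
    using D.mul_bilinear by (simp_all add: bilin_on_def)
  note lin_on_fps_coefficient(2)[OF cx_module_axioms subspace_UNIV this(1), of g f]
    and lin_on_fps_coefficient(2)[OF cx_module_axioms subspace_UNIV this(2), of f "fps_const (fps_nth g 0)"]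
  moreover obtain C where "\<And>a b. smul (fps_const a) (fps_const b) = Abs_fps (\<lambda>r. C r a b)" "C 0 = mul"
    using deformation by (auto simp: hermitian_deformation_def formal_deformation_def)
  ultimately show ?thesis
    by simp
qed

text \<open>By bilinearity, the powers \<lambda>^j and \<lambda>^k dividing the factors come out of
  the product.\<close>

lemma smul_low:
  assumes "\<And>n. n < j \<Longrightarrow> fps_nth f n = 0" and "\<And>n. n < k \<Longrightarrow> fps_nth g n = 0" and "n < j + k"
  shows "fps_nth (smul f g) n = 0"
proof -
  have "smul f g = smul (fps_scale scl (cx_lam j) (fps_shift j f)) (fps_scale scl (cx_lam k) (fps_shift k g))"
    using fps_eq_scale_lam_shift[of j f] fps_eq_scale_lam_shift[of k g] assms by simp
  then have "smul f g = fps_scale scl (cx_lam (j + k)) (smul (fps_shift j f) (fps_shift k g))"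
    by (simp add: D.mul_scale_left D.mul_scale_right cx_lam_mult add.commute)
  then show ?thesis
    using assms by (simp add: fps_nth_scale_lam)
qed

lemma vec_fps_nth_0_mat_vec:
  "vec_fps_nth 0 (mat_vec smul L x) = mat_vec mul (\<chi> i j. fps_nth (L $ i $ j) 0) (vec_fps_nth 0 x)"
  by (simp add: vec_fps_nth_def mat_vec_def fps_sum_nth smul_nth_0)

lemma canonical_inner_nth_0:
  "fps_nth (canonical_inner smul (fps_star star) x y) 0 = canonical_inner mul star (vec_fps_nth 0 x) (vec_fps_nth 0 y)"
  by (simp add: vec_fps_nth_def canonical_inner_def fps_sum_nth smul_nth_0 fps_star_def)

lemma complete_star_algebra_matrix:
  "complete_star_algebra (vec_scale (vec_scale (fps_scale scl))) (mat_mul smul)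
    (mat_one (fps_const one)) (mat_star (fps_star star)) (mat_fps_ideal :: nat \<Rightarrow> ('a fps ^ 'n ^ 'n) set)"
proof -
  interpret MM: unital_star_algebra "vec_scale (vec_scale (fps_scale scl))" "mat_mul smul"
    "mat_one (fps_const one) :: 'a fps ^ 'n ^ 'n" "mat_star (fps_star star)"
    by (rule D.unital_star_algebra_matrix)
  show ?thesis
  proof unfold_locales
    fix k
    show "MM.subspace (mat_fps_ideal k)"
      by (auto simp: MM.subspace_def mat_fps_ideal_def vec_scale_def fps_scale_def)
  next
    fix a b :: "'a fps ^ 'n ^ 'n" and j k
    assume "a \<in> mat_fps_ideal j" "b \<in> mat_fps_ideal k"
    then show "mat_mul smul a b \<in> mat_fps_ideal (j + k)"
      by (auto simp: mat_fps_ideal_def mat_mul_def fps_sum_nth intro!: sum.neutral smul_low[where j = j and k = k])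
  next
    fix a :: "'a fps ^ 'n ^ 'n"
    assume "\<And>k. a \<in> mat_fps_ideal k"
    then show "a = 0"
      by (auto simp: mat_fps_ideal_def vec_eq_iff fps_eq_iff)
  next
    fix s :: "nat \<Rightarrow> 'a fps ^ 'n ^ 'n"
    assume s: "\<And>k. s (Suc k) - s k \<in> mat_fps_ideal k"
    \<comment> \<open>The coefficient of order \<open>n\<close> is stable from index
      \<open>Suc n\<close> on, because \<open>s (Suc k) - s k\<close> vanishes only in orders below
      \<open>k\<close>.\<close>
    define l :: "'a fps ^ 'n ^ 'n" where "l = (\<chi> i j. Abs_fps (\<lambda>n. fps_nth (s (Suc n) $ i $ j) n))"
    have s_eq: "fps_nth (s k $ i $ j) n = fps_nth (s (Suc n) $ i $ j) n" if "Suc n \<le> k" for i j n k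
      using that
    proof (induction k rule: dec_induct)
      case base
      show ?case ..
    next
      case (step k)
      then show ?case
        using s[of k] by (simp add: mat_fps_ideal_def)
    qed
    have "fps_nth ((l - s k) $ i $ j) n = 0" if "n < k" for i j n k
      using s_eq[of n k i j] that by (simp add: l_def)
    then have "l - s k \<in> mat_fps_ideal k" for k
      by (simp add: mat_fps_ideal_def)
    then show "\<exists>l. \<forall>k. l - s k \<in> mat_fps_ideal k"
      by blast
  next
    fix a :: "'a fps ^ 'n ^ 'n" and k
    assume "a \<in> mat_fps_ideal k"
    then show "mat_star (fps_star star) a \<in> mat_fps_ideal k"
      by (simp add: mat_fps_ideal_def mat_star_def fps_star_def star_zero)
  next
    show "mat_fps_ideal 0 = (UNIV :: ('a fps ^ 'n ^ 'n) set)"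
      by (simp add: mat_fps_ideal_def)
  next
    fix k
    show "mat_fps_ideal (Suc k) \<subseteq> (mat_fps_ideal k :: ('a fps ^ 'n ^ 'n) set)"
      by (auto simp: mat_fps_ideal_def)
  qed
qed

text \<open>The constant matrix \<open>Q\<close> with entries from \<open>P\<^sub>0\<close> is
  Hermitian, as the involution acts coefficientwise, and idempotent modulo \<lambda>, as the product
  is undeformed in order zero.\<close>

lemma lift_matrix_projection:
  fixes P\<^sub>0 :: "'a ^ 'n ^ 'n"
  assumes "projection mul star P\<^sub>0"
  obtains P where "projection smul (fps_star star) P" and "(\<chi> i j. fps_nth (P $ i $ j) 0) = P\<^sub>0"
proof -
  interpret MM: complete_star_algebra "vec_scale (vec_scale (fps_scale scl))" "mat_mul smul"
    "mat_one (fps_const one) :: 'a fps ^ 'n ^ 'n" "mat_star (fps_star star)" mat_fps_ideal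
    by (rule complete_star_algebra_matrix)
  define Q :: "'a fps ^ 'n ^ 'n" where "Q = (\<chi> i j. fps_const (P\<^sub>0 $ i $ j))"
  have "mat_mul mul P\<^sub>0 P\<^sub>0 $ i $ j = P\<^sub>0 $ i $ j" "mat_star star P\<^sub>0 $ i $ j = P\<^sub>0 $ i $ j" for i j
    using assms by (simp_all add: projection_conv)
  then have P0: "(\<Sum>k\<in>UNIV. mul (P\<^sub>0 $ i $ k) (P\<^sub>0 $ k $ j)) = P\<^sub>0 $ i $ j" "star (P\<^sub>0 $ j $ i) = P\<^sub>0 $ i $ j" for i j
    by (simp_all add: mat_mul_def mat_star_def)
  have "mat_mul smul Q Q - Q \<in> mat_fps_ideal 1"
    by (simp add: mat_fps_ideal_def mat_mul_def Q_def fps_sum_nth smul_nth_0 P0)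
  moreover have "mat_star (fps_star star) Q = Q"
    by (simp add: mat_star_def fps_star_def Q_def vec_eq_iff fps_eq_iff P0 star_zero)
  ultimately obtain P where "mat_mul smul P P = P" "mat_star (fps_star star) P = P" "P - Q \<in> mat_fps_ideal 1"
    by (rule MM.lift_projection)
  then show thesis
    by (intro that[of P]) (simp_all add: projection_conv mat_fps_ideal_def Q_def vec_eq_iff)
qed

end


section \<open>The deformed projective module\<close>

text \<open>A deformation lives on series of vectors, while matrices over the deformed algebra act
  on vectors of series. \<open>fps_vec\<close> and \<open>vec_fps\<close> are the mutually inverse
  translations.\<close>

definition fps_vec :: "('a::zero ^ 'n) fps \<Rightarrow> 'a fps ^ 'n"
  where "fps_vec x = (\<chi> i. Abs_fps (\<lambda>n. fps_nth x n $ i))"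

definition vec_fps :: "'a::zero fps ^ 'n \<Rightarrow> ('a ^ 'n) fps"
  where "vec_fps y = Abs_fps (\<lambda>n. vec_fps_nth n y)"

lemma fps_vec_vec_fps [simp]: "fps_vec (vec_fps y) = y"
  by (simp add: fps_vec_def vec_fps_def vec_fps_nth_def vec_eq_iff fps_eq_iff)

lemma vec_fps_fps_vec [simp]: "vec_fps (fps_vec x) = x"
  by (simp add: fps_vec_def vec_fps_def vec_fps_nth_def vec_eq_iff fps_eq_iff)

lemma vec_fps_nth_fps_vec [simp]: "vec_fps_nth n (fps_vec x) = fps_nth x n"
  by (simp add: fps_vec_def vec_fps_nth_def vec_eq_iff)

lemma fps_nth_vec_fps [simp]: "fps_nth (vec_fps y) n = vec_fps_nth n y"
  by (simp add: vec_fps_def)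

lemma fps_vec_add: "fps_vec (x + y) = fps_vec x + fps_vec (y :: ('a::ab_group_add ^ 'n) fps)"
  by (simp add: fps_vec_def vec_eq_iff fps_eq_iff)

lemma fps_vec_zero: "fps_vec 0 = 0"
  by (simp add: fps_vec_def vec_eq_iff fps_eq_iff)

lemma vec_fps_add: "vec_fps (x + y) = vec_fps x + vec_fps (y :: 'a::ab_group_add fps ^ 'n)"
  by (metis fps_vec_add fps_vec_vec_fps vec_fps_fps_vec)

lemma fps_vec_scale: "fps_vec (fps_scale (vec_scale scl) c x) = vec_scale (fps_scale scl) c (fps_vec x)"
  by (simp add: fps_vec_def vec_scale_def fps_scale_def vec_eq_iff fps_eq_iff)

lemma vec_fps_scale: "vec_fps (vec_scale (fps_scale scl) c x) = fps_scale (vec_scale scl) c (vec_fps x)"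
  by (metis fps_vec_scale fps_vec_vec_fps vec_fps_fps_vec)

lemma (in unital_algebra) projection_module_iff:
  assumes "mat_mul mul P P = P"
  shows "x \<in> projection_module mul P \<longleftrightarrow> mat_vec mul P x = x"
  using assms by (auto simp: projection_module_def mat_vec_mul intro: range_eqI[OF sym])

text \<open>One lift \<open>P\<close> of \<open>P\<^sub>0\<close> is fixed, and the inner-product
  module condition enters as nondegeneracy, to which \<open>inner_product_module_iff\<close> reduces
  it.\<close>

locale deformed_projection = deformed_algebra scl mul one star smul
  for scl :: "'r::rat_ordered_ring cx \<Rightarrow> 'a::ab_group_add \<Rightarrow> 'a" and mul one star smul +
  fixes P\<^sub>0 :: "'a ^ 'n ^ 'n" and P :: "'a fps ^ 'n ^ 'n"
  assumes projection_P\<^sub>0: "projection mul star P\<^sub>0"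
    and projection_P: "projection smul (fps_star star) P"
    and P_nth_0: "(\<chi> i j. fps_nth (P $ i $ j) 0) = P\<^sub>0"
    and nondegenerate: "x \<in> projection_module mul P\<^sub>0 \<Longrightarrow> canonical_inner mul star x x = 0 \<Longrightarrow> x = 0"
begin

abbreviation "E \<equiv> projection_module mul P\<^sub>0"
abbreviation "M \<equiv> projection_module smul P"
abbreviation "scaleE \<equiv> fps_scale (vec_scale scl) :: _ \<Rightarrow> ('a ^ 'n) fps \<Rightarrow> _"
abbreviation "scaleM \<equiv> vec_scale (fps_scale scl) :: _ \<Rightarrow> 'a fps ^ 'n \<Rightarrow> _"
abbreviation "ipM \<equiv> canonical_inner smul (fps_star star) :: 'a fps ^ 'n \<Rightarrow> 'a fps ^ 'n \<Rightarrow> _"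

sublocale V: module "vec_scale scl :: 'r cx \<Rightarrow> 'a ^ 'n \<Rightarrow> 'a ^ 'n"
  by (rule module_vec_scale)

sublocale V: cx_module "vec_scale scl :: 'r cx \<Rightarrow> 'a ^ 'n \<Rightarrow> 'a ^ 'n" ..

sublocale VE: module scaleE
  by (rule V.module_fps)

sublocale VM: module scaleM
  by (rule D.module_vec_scale)

lemma P_simps: "mat_mul smul P P = P" "mat_star (fps_star star) P = P"
    "mat_mul mul P\<^sub>0 P\<^sub>0 = P\<^sub>0" "mat_star star P\<^sub>0 = P\<^sub>0"
  using projection_P projection_P\<^sub>0 by (auto simp: projection_conv)

lemmas E_iff = projection_module_iff[OF P_simps(3)]
  and M_iff = D.projection_module_iff[OF P_simps(1)]

lemma subspace_E: "V.subspace E"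
  using right_module_projection_module[of P\<^sub>0] by (simp add: right_module_def)

lemma subspace_fps_E: "VE.subspace (fps_over E)"
  using subspace_E by (rule V.subspace_fps_over)

lemma subspace_M: "VM.subspace M"
  using D.right_module_projection_module[of P] by (simp add: right_module_def)

lemma act_M: "y \<in> M \<Longrightarrow> vec_act smul y a \<in> M"
  using D.right_module_projection_module[of P] by (simp add: right_module_def)

lemma mat_vec_P_in_M: "mat_vec smul P y \<in> M"
  by (simp add: projection_module_def)

lemma mat_vec_P_nth_0: "vec_fps_nth 0 (mat_vec smul P y) = mat_vec mul P\<^sub>0 (vec_fps_nth 0 y)"
  by (simp add: vec_fps_nth_0_mat_vec P_nth_0)

lemma vec_fps_nth_0_M: "y \<in> M \<Longrightarrow> vec_fps_nth 0 y \<in> E"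
  using mat_vec_P_nth_0[of y] by (simp add: M_iff E_iff)

lemma fps_over_nth_0: "x \<in> fps_over E \<Longrightarrow> fps_nth x 0 \<in> E"
  by (simp add: fps_over_def)

section \<open>Identification of the series over \<open>E\<close> with \<open>M\<close>\<close>

definition embedding :: "('a ^ 'n) fps \<Rightarrow> 'a fps ^ 'n"
  where "embedding x = mat_vec smul P (fps_vec x)"

lemma embedding_in_M: "embedding x \<in> M"
  by (simp add: embedding_def mat_vec_P_in_M)

lemma embedding_nth_0: "x \<in> fps_over E \<Longrightarrow> vec_fps_nth 0 (embedding x) = fps_nth x 0"
  using fps_over_nth_0[of x] by (simp add: embedding_def mat_vec_P_nth_0 E_iff)

lemma embedding_add: "embedding (x + y) = embedding x + embedding y"
  by (simp add: embedding_def fps_vec_add D.mat_vec_add)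

lemma embedding_scale: "embedding (scaleE c x) = scaleM c (embedding x)"
  by (simp add: embedding_def fps_vec_scale D.mat_vec_scale)

lemma lin_on_embedding: "lin_on scaleE (fps_over E) scaleM embedding"
  by (simp add: lin_on_def embedding_add embedding_scale)

text \<open>The map is the identity in order zero. The bijectivity criterion for such maps compares
  sets of series of the same type, so \<open>M\<close> is first pulled back to \<open>Y\<close>
  along \<open>fps_vec\<close>.\<close>

lemma bij_betw_embedding: "bij_betw embedding (fps_over E) M"
proof -
  define Y where "Y = fps_vec -` M"
  have "bij_betw (vec_fps \<circ> embedding) (fps_over E) Y"
  proof (rule V.bij_betw_fps_over_if_unipotent[OF subspace_E])
    show "VE.subspace Y"
      using subspace_M by (auto simp: VE.subspace_def VM.subspace_def Y_def fps_vec_zero fps_vec_add fps_vec_scale)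
    \<comment> \<open>Membership in \<open>M\<close> means being fixed by \<open>P\<close>, and
      multiplication by \<lambda> can be cancelled from that equation.\<close>
    show "y \<in> Y" if "scaleE (cx_lam 1) y \<in> Y" for y
    proof -
      have "scaleE (cx_lam 1) (vec_fps (embedding y)) = scaleE (cx_lam 1) y"
        using that
        by (metis Y_def M_iff vimageD vec_fps_fps_vec vec_fps_scale fps_vec_scale D.mat_vec_scale embedding_def)
      then have "fps_nth (scaleE (cx_lam 1) (vec_fps (embedding y))) (Suc n) = fps_nth (scaleE (cx_lam 1) y) (Suc n)" for n
        by simp
      then have "vec_fps (embedding y) = y"
        by (simp add: V.fps_nth_scale_lam fps_eq_iff)
      then have "fps_vec y = embedding y"
        by (metis fps_vec_vec_fps)
      then show ?thesis
        by (simp add: Y_def embedding_in_M)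
    qed
    show "fps_nth y 0 \<in> E" if "y \<in> Y" for y
      using vec_fps_nth_0_M[of "fps_vec y"] that by (simp add: Y_def)
    show "lin_on scaleE (fps_over E) scaleE (vec_fps \<circ> embedding)"
      by (simp add: lin_on_def embedding_add embedding_scale vec_fps_add vec_fps_scale)
  qed (simp_all add: Y_def embedding_in_M embedding_nth_0)
  moreover have "bij_betw fps_vec Y M"
    by (rule bij_betw_byWitness[of _ vec_fps]) (auto simp: Y_def)
  ultimately have "bij_betw (fps_vec \<circ> (vec_fps \<circ> embedding)) (fps_over E) M"
    by (rule bij_betw_trans)
  moreover have "fps_vec \<circ> (vec_fps \<circ> embedding) = embedding"
    by (simp add: fun_eq_iff)
  ultimately show ?thesis
    by simp
qed

section \<open>The inner product on \<open>M\<close>\<close>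

lemma inner_scale_lam: "ipM (scaleM (cx_lam k) x) (scaleM (cx_lam k) y) = fps_scale scl (cx_lam (k + k)) (ipM x y)"
  by (simp add: canonical_inner_def vec_scale_def D.star_scale D.mul_scale_left D.mul_scale_right
      cx_cnj_lam cx_lam_mult D.scale_sum_right)

text \<open>If \<open>x\<close> is \<lambda>^n times \<open>z\<close>, the inner product of its
  image with itself is divisible by \<lambda>^(2n), with coefficient at \<open>2n\<close> given by
  the undeformed inner product of the constant term of \<open>z\<close> with itself. Nondegeneracy
  kills that constant term, and induction continues.\<close>

lemma inner_definite:
  assumes "y \<in> M" and "ipM y y = 0"
  shows "y = 0"
proof -
  obtain x where x: "x \<in> fps_over E" "y = embedding x"
    using assms(1) bij_betw_embedding by (auto simp: bij_betw_def)
  have "fps_nth x n = 0" for n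
  proof (induction n rule: less_induct)
    case (less n)
    define z where "z = fps_shift n x"
    have "scaleE (cx_lam n) z = x"
      unfolding z_def using less by (intro V.fps_eq_scale_lam_shift[symmetric])
    then have "fps_scale scl (cx_lam (n + n)) (ipM (embedding z) (embedding z)) = 0"
      using assms(2) unfolding x(2) by (metis embedding_scale inner_scale_lam)
    then have "fps_nth (ipM (embedding z) (embedding z)) 0 = 0"
      by (metis add_diff_cancel_left' add_0_right fps_nth_scale_lam fps_zero_nth less_irrefl)
    moreover have z: "z \<in> fps_over E"
      using x(1) unfolding z_def by (rule fps_shift_in_fps_over)
    ultimately have "canonical_inner mul star (fps_nth z 0) (fps_nth z 0) = 0"
      by (simp add: canonical_inner_nth_0 embedding_nth_0)
    then have "fps_nth z 0 = 0"
      using fps_over_nth_0[OF z] by (intro nondegenerate)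
    then show ?case
      by (simp add: z_def)
  qed
  then have "x = 0"
    by (simp add: fps_eq_iff)
  then show ?thesis
    using x(2) embedding_add[of 0 0] by simp
qed

text \<open>The deformed algebra is itself a star-algebra over an ordered ring extended by a root of
  minus one, so the criterion for canonical inner products applies and leaves only
  definiteness.\<close>

lemma inner_product_M: "inner_product (fps_scale scl) smul (fps_star star) scaleM M (vec_act smul) ipM"
  using D.inner_product_module_iff[OF projection_P] inner_definite
  by (simp add: inner_product_module_def)

section \<open>Existence by transport of structure from \<open>M\<close>\<close>

theorem hermitian_module_deformation_exists:
  "\<exists>bact h. hermitian_module_deformation scl one star smul (vec_scale scl) E (vec_act mul)
    (canonical_inner mul star) bact h"
proof -
  define bact where "bact = (\<lambda>x a. inv_into (fps_over E) embedding (vec_act smul (embedding x) a))"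
  define h where "h = (\<lambda>x y. ipM (embedding x) (embedding y))"
  have right: "right_module (fps_scale scl) smul (fps_const one) scaleE (fps_over E) bact"
    unfolding bact_def
    by (rule right_module_transport[OF D.right_module_projection_module VE.module_axioms
          subspace_fps_E lin_on_embedding bij_betw_embedding])
  have inner: "inner_product (fps_scale scl) smul (fps_star star) scaleE (fps_over E) bact h"
    unfolding bact_def h_def
    by (rule inner_product_transport[OF inner_product_M VE.module_axioms subspace_fps_E act_M
          lin_on_embedding bij_betw_embedding])
  have const: "fps_const x \<in> fps_over E" if "x \<in> E" for x
    using that V.subspace_0[OF subspace_E] by (rule fps_const_in_fps_over)
  have bact_E: "bact x a \<in> fps_over E" if "x \<in> fps_over E" for x a
    using right that by (simp add: right_module_def)
  have embedding_bact: "embedding (bact x a) = vec_act smul (embedding x) a" for x a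
    using bij_betw_embedding act_M[OF embedding_in_M] by (auto simp: bact_def bij_betw_def f_inv_into_f)
  have bact_0: "fps_nth (bact (fps_const x) (fps_const a)) 0 = vec_act mul x a" if "x \<in> E" for x a
  proof -
    have "fps_nth (bact (fps_const x) (fps_const a)) 0 = vec_fps_nth 0 (vec_act smul (embedding (fps_const x)) (fps_const a))"
      using embedding_nth_0[OF bact_E[OF const[OF that]]] by (simp add: embedding_bact)
    also have "\<dots> = vec_act mul (vec_fps_nth 0 (embedding (fps_const x))) a"
      by (simp add: vec_fps_nth_def vec_act_def smul_nth_0)
    finally show ?thesis
      by (simp add: embedding_nth_0[OF const[OF that]])
  qed
  define R where "R = (\<lambda>r x a. fps_nth (bact (fps_const x) (fps_const a)) r)"
  have "bilin_on (vec_scale scl) E scl UNIV (vec_scale scl) (R r)" for r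
    unfolding bilin_on_def R_def
  proof (intro conjI ballI)
    show "lin_on (vec_scale scl) E (vec_scale scl) (\<lambda>x. fps_nth (bact (fps_const x) (fps_const a)) r)" for a
      using right by (intro V.lin_on_fps_coefficient[OF V.cx_module_axioms subspace_E, of "\<lambda>x. bact x (fps_const a)"])
        (simp add: right_module_def bilin_on_def)
    show "lin_on scl UNIV (vec_scale scl) (\<lambda>a. fps_nth (bact (fps_const x) (fps_const a)) r)" if "x \<in> E" for x
      using right const[OF that]
      by (intro lin_on_fps_coefficient[OF V.cx_module_axioms subspace_UNIV, of "bact (fps_const x)"])
        (simp add: right_module_def bilin_on_def)
  qed
  moreover have "R r x a \<in> E" if "x \<in> E" for r x a
    using bact_E[OF const[OF that]] by (simp add: fps_over_def R_def)
  moreover have "fps_nth (h (fps_const x) (fps_const y)) 0 = canonical_inner mul star x y" if "x \<in> E" "y \<in> E" for x y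
    using that by (simp add: h_def canonical_inner_nth_0 embedding_nth_0 const)
  ultimately have "hermitian_module_deformation scl one star smul (vec_scale scl) E (vec_act mul)
      (canonical_inner mul star) bact h"
    unfolding hermitian_module_deformation_def using right inner bact_0
    by (intro conjI exI[of _ R] exI[of _ "\<lambda>r x y. fps_nth (h (fps_const x) (fps_const y)) r"])
      (simp_all add: R_def fps_nth_inverse)
  then show ?thesis
    by blast
qed


text \<open>Each deformation is compared with the fixed model \<open>M\<close>. The clause on order
  zero ensures that the comparison of two deformations is the identity in order zero.\<close>

lemma hermitian_module_deformation_trivialization:
  assumes def: "hermitian_module_deformation scl one star smul (vec_scale scl) E (vec_act mul)
    (canonical_inner mul star) bact h"
  obtains \<Phi> where "isometry_on scaleM M (vec_act smul) ipM scaleE (fps_over E) bact h \<Phi>"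
    and "\<And>y. y \<in> M \<Longrightarrow> fps_nth (\<Phi> y) 0 = vec_fps_nth 0 y"
proof -

  \<comment> \<open>Calculation rules for the given action\<close>
  have right: "right_module (fps_scale scl) smul (fps_const one) scaleE (fps_over E) bact"
    and inner: "inner_product (fps_scale scl) smul (fps_star star) scaleE (fps_over E) bact h"
    using def by (auto simp: hermitian_module_deformation_def)
  obtain R where R: "\<And>x a. x \<in> E \<Longrightarrow> bact (fps_const x) (fps_const a) = Abs_fps (\<lambda>r. R r x a)"
      "\<And>x a. x \<in> E \<Longrightarrow> R 0 x a = vec_act mul x a"
    using def by (auto simp: hermitian_module_deformation_def)
  obtain hr where hr: "\<And>x y. x \<in> E \<Longrightarrow> y \<in> E \<Longrightarrow> h (fps_const x) (fps_const y) = Abs_fps (\<lambda>r. hr r x y)"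
      "\<And>x y. x \<in> E \<Longrightarrow> y \<in> E \<Longrightarrow> hr (0 :: nat) x y = canonical_inner mul star x y"
    using def by (auto simp: hermitian_module_deformation_def)
  have const: "fps_const x \<in> fps_over E" if "x \<in> E" for x
    using that V.subspace_0[OF subspace_E] by (rule fps_const_in_fps_over)
  have bact_E: "bact x a \<in> fps_over E" if "x \<in> fps_over E" for x a
    using right that by (simp add: right_module_def)
  have bact_lin: "lin_on scaleE (fps_over E) scaleE (\<lambda>x. bact x a)"
    "x \<in> fps_over E \<Longrightarrow> lin_on (fps_scale scl) UNIV scaleE (bact x)" for a x
    using right by (simp_all add: right_module_def bilin_on_def)
  have bact_assoc: "bact (bact x a) b = bact x (smul a b)" if "x \<in> fps_over E" for x a b
    using right that by (simp add: right_module_def)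
  have bact_0: "fps_nth (bact x a) 0 = vec_act mul (fps_nth x 0) (fps_nth a 0)" if x: "x \<in> fps_over E" for x a
    using V.lin_on_fps_coefficient(2)[OF V.cx_module_axioms subspace_E bact_lin(1) x, of a]
      lin_on_fps_coefficient(2)[OF V.cx_module_axioms subspace_UNIV, of "bact (fps_const (fps_nth x 0))" a]
      bact_lin(2)[OF const[OF fps_over_nth_0[OF x]]] R fps_over_nth_0[OF x]
    by simp
  have sum_E: "(\<Sum>i\<in>A. bact (x i) (a i)) \<in> fps_over E" if "\<And>i. x i \<in> fps_over E" for x :: "'n \<Rightarrow> _" and a A
    using that bact_E by (auto intro!: VE.subspace_sum[OF subspace_fps_E])
  have bact_zero: "bact 0 b = 0" for b
  proof -
    have "bact (0 + 0) b = bact 0 b + bact 0 b"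
      using bact_lin(1)[of b] VE.subspace_0[OF subspace_fps_E] unfolding lin_on_def by blast
    then show ?thesis
      by simp
  qed
  have bact_sum: "bact (\<Sum>i\<in>A. bact (x i) (a i)) b = (\<Sum>i\<in>A. bact (x i) (smul (a i) b))"
    if x: "\<And>i. x i \<in> fps_over E" for x :: "'n \<Rightarrow> _" and a b A
  proof (induction A rule: infinite_finite_induct)
    case (insert i A)
    then show ?case
      using bact_lin(1)[of b] bact_E[OF x] sum_E[OF x] by (simp add: lin_on_def bact_assoc x)
  qed (simp_all add: bact_zero)

  \<comment> \<open>Sesquilinearity and order zero part of the given inner product\<close>
  have h_comb: "h x (scaleE c y + scaleE d z) = fps_scale scl c (h x y) + fps_scale scl d (h x z)"
    if "x \<in> fps_over E" "y \<in> fps_over E" "z \<in> fps_over E" for x y z c d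
    using inner that by (simp add: inner_product_def)
  have h_add: "h x (y + z) = h x y + h x z" if "x \<in> fps_over E" "y \<in> fps_over E" "z \<in> fps_over E" for x y z
    using h_comb[OF that, of 1 1] by simp
  have h_0: "h x 0 = 0" if "x \<in> fps_over E" for x
    using h_add[OF that, of 0 0] VE.subspace_0[OF subspace_fps_E] by simp
  have h_scale: "h x (scaleE c y) = fps_scale scl c (h x y)" if "x \<in> fps_over E" "y \<in> fps_over E" for x y c
    using h_comb[OF that that(2), of c 0] by simp
  have h_star: "fps_star star (h x y) = h y x" if "x \<in> fps_over E" "y \<in> fps_over E" for x y
    using inner that by (simp add: inner_product_def)
  have h_bact: "h x (bact y a) = smul (h x y) a" if "x \<in> fps_over E" "y \<in> fps_over E" for x y a
    using inner that by (simp add: inner_product_def)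
  have h_sum: "h x (\<Sum>i\<in>A. bact (y i) (a i)) = (\<Sum>i\<in>A. smul (h x (y i)) (a i))"
    if x: "x \<in> fps_over E" and y: "\<And>i. y i \<in> fps_over E" for x and y :: "'n \<Rightarrow> _" and a A
    using sum_E[OF y] by (induction A rule: infinite_finite_induct) (simp_all add: h_0 h_add h_bact x y bact_E)
  have h_sum_left: "h (\<Sum>i\<in>A. bact (y i) (a i)) x = (\<Sum>i\<in>A. smul (fps_star star (a i)) (h (y i) x))"
    if x: "x \<in> fps_over E" and y: "\<And>i. y i \<in> fps_over E" for x and y :: "'n \<Rightarrow> _" and a A
    using arg_cong[OF h_sum[OF x y], of "fps_star star"]
    by (simp add: h_star x y sum_E D.star_sum D.star_mul)
  have h_nth_0: "fps_nth (h x y) 0 = canonical_inner mul star (fps_nth x 0) (fps_nth y 0)"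
    if x: "x \<in> fps_over E" and y: "y \<in> fps_over E" for x y
  proof -
    have lin: "lin_on scaleE (fps_over E) (fps_scale scl) (h x)" if "x \<in> fps_over E" for x
      using that by (simp add: lin_on_def h_add h_scale)
    \<comment> \<open>Linearity is available in the second argument; the first one is reached
      through Hermitian symmetry.\<close>
    have swap: "fps_nth (h x y) 0 = star (fps_nth (h y x) 0)" if "x \<in> fps_over E" "y \<in> fps_over E" for x y
      using h_star[OF that(2,1)] by (simp add: fps_star_def fps_eq_iff)
    have right_const: "fps_nth (h x y) 0 = fps_nth (h x (fps_const (fps_nth y 0))) 0"
      if "x \<in> fps_over E" "y \<in> fps_over E" for x y
      using V.lin_on_fps_coefficient(2)[OF cx_module_axioms subspace_E lin] that by blast
    have c: "fps_const (fps_nth x 0) \<in> fps_over E" "fps_const (fps_nth y 0) \<in> fps_over E"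
      using x y by (simp_all add: const fps_over_nth_0)
    have "fps_nth (h x y) 0 = fps_nth (h (fps_const (fps_nth x 0)) (fps_const (fps_nth y 0))) 0"
      using right_const[OF x y] swap[OF x c(2)] right_const[OF c(2) x] swap[OF c(1,2)] by simp
    then show ?thesis
      using hr x y by (simp add: fps_over_nth_0)
  qed

  \<comment> \<open>The module isomorphism \<open>\<phi>\<close> from \<open>M\<close>\<close>
  define e :: "'n \<Rightarrow> 'a ^ 'n" where "e i = mat_vec mul P\<^sub>0 (axis i one)" for i
  define f :: "'n \<Rightarrow> 'a fps ^ 'n" where "f i = mat_vec smul P (axis i (fps_const one))" for i
  define \<phi> where "\<phi> y = (\<Sum>i\<in>UNIV. bact (fps_const (e i)) (y $ i))" for y
  have e_E: "fps_const (e i) \<in> fps_over E" for i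
    by (rule const) (simp add: e_def projection_module_def)
  have f_M: "f i \<in> M" for i
    by (simp add: f_def mat_vec_P_in_M)
  have \<phi>_E: "\<phi> y \<in> fps_over E" for y
    unfolding \<phi>_def by (rule sum_E) (rule e_E)
  have \<phi>_act: "\<phi> (vec_act smul y a) = bact (\<phi> y) a" for y a
    by (simp add: \<phi>_def vec_act_def bact_sum e_E)
  have \<phi>_add: "\<phi> (x + y) = \<phi> x + \<phi> y" for x y
    using bact_lin(2)[OF e_E] by (simp add: \<phi>_def lin_on_def sum.distrib)
  have \<phi>_scale: "\<phi> (scaleM c y) = scaleE c (\<phi> y)" for c y
    using bact_lin(2)[OF e_E] by (simp add: \<phi>_def vec_scale_def lin_on_def VE.scale_sum_right)
  have \<phi>_nth_0: "fps_nth (\<phi> y) 0 = vec_fps_nth 0 y" if "y \<in> M" for y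
  proof -
    have "fps_nth (\<phi> y) 0 = mat_vec mul P\<^sub>0 (vec_fps_nth 0 y)"
      by (subst mat_vec_conv_columns) (simp add: \<phi>_def fps_sum_nth bact_0[OF e_E] vec_fps_nth_def flip: e_def)
    then show ?thesis
      using vec_fps_nth_0_M[OF that] by (simp add: E_iff)
  qed
  \<comment> \<open>The criterion needs series on both sides, so it is applied to the composite with
    \<open>embedding\<close>, whose bijectivity then gives that of \<open>\<phi>\<close>.\<close>
  have "bij_betw (\<phi> \<circ> embedding) (fps_over E) (fps_over E)"
  proof (rule V.bij_betw_fps_over_if_unipotent[OF subspace_E subspace_fps_E])
    show "y \<in> fps_over E" if "scaleE (cx_lam 1) y \<in> fps_over E" for y
    proof -
      have "fps_nth (scaleE (cx_lam 1) y) (Suc n) \<in> E" for n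
        using that by (simp only: fps_over_def mem_Collect_eq)
      then show ?thesis
        by (simp add: fps_over_def V.fps_nth_scale_lam)
    qed
    show "lin_on scaleE (fps_over E) scaleE (\<phi> \<circ> embedding)"
      by (simp add: lin_on_def embedding_add embedding_scale \<phi>_add \<phi>_scale)
  qed (simp_all add: fps_over_nth_0 \<phi>_E \<phi>_nth_0 embedding_in_M embedding_nth_0)
  then have bij_\<phi>: "bij_betw \<phi> M (fps_over E)"
    using bij_betw_comp_iff[OF bij_betw_embedding] by blast

  \<comment> \<open>The Gram matrix of the pulled-back inner product\<close>
  define u where "u i = \<phi> (f i)" for i
  have u_E: "u i \<in> fps_over E" for i
    by (simp add: u_def \<phi>_E)
  have \<phi>_sum: "\<phi> (\<Sum>i\<in>A. g i) = (\<Sum>i\<in>A. \<phi> (g i))" for g :: "'n \<Rightarrow> _" and A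
    using \<phi>_add[of 0 0] by (induction A rule: infinite_finite_induct) (simp_all add: \<phi>_add)
  have \<phi>_expand: "\<phi> y = (\<Sum>i\<in>UNIV. bact (u i) (y $ i))" if "y \<in> M" for y
  proof -
    have "y = (\<Sum>i\<in>UNIV. vec_act smul (f i) (y $ i))"
      using D.mat_vec_conv_columns[of P y] that by (simp add: M_iff f_def)
    then have "\<phi> y = \<phi> (\<Sum>i\<in>UNIV. vec_act smul (f i) (y $ i))"
      by (rule arg_cong)
    then show ?thesis
      by (simp add: \<phi>_sum \<phi>_act u_def)
  qed
  \<comment> \<open>The vectors \<open>u i\<close> come from the columns of \<open>P\<close>, so
    each \<open>u j\<close> is the combination of the \<open>u k\<close> with coefficients from
    column \<open>j\<close> of \<open>P\<close>. This is what forces \<open>H P = H\<close>.\<close>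
  define H :: "'a fps ^ 'n ^ 'n" where "H = (\<chi> i j. h (u i) (u j))"
  have h_\<phi>: "h (\<phi> x) (\<phi> y) = ipM x (mat_vec smul H y)" if "x \<in> M" "y \<in> M" for x y
  proof -
    have "h (\<phi> x) (\<phi> y) = (\<Sum>i\<in>UNIV. smul (fps_star star (x $ i)) (h (u i) (\<phi> y)))"
      by (simp add: \<phi>_expand[OF that(1)] h_sum_left \<phi>_E u_E)
    then show ?thesis
      by (simp add: \<phi>_expand[OF that(2)] h_sum u_E canonical_inner_def mat_vec_def H_def)
  qed

  \<comment> \<open>Symmetry, compatibility with \<open>P\<close> and order zero part of the Gram
    matrix\<close>
  interpret MM: complete_star_algebra "vec_scale (vec_scale (fps_scale scl))" "mat_mul smul"
    "mat_one (fps_const one) :: 'a fps ^ 'n ^ 'n" "mat_star (fps_star star)" mat_fps_ideal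
    by (rule complete_star_algebra_matrix)
  have H_star: "mat_star (fps_star star) H = H"
    by (simp add: mat_star_def H_def vec_eq_iff h_star u_E)
  have HP: "mat_mul smul H P = H"
  proof -
    have "(\<Sum>k\<in>UNIV. smul (h (u i) (u k)) (P $ k $ j)) = h (u i) (u j)" for i j
    proof -
      have "f j $ k = P $ k $ j" for k
        by (simp add: f_def D.mat_vec_axis)
      then have "u j = (\<Sum>k\<in>UNIV. bact (u k) (P $ k $ j))"
        using \<phi>_expand[OF f_M[of j]] by (simp add: u_def)
      then have "h (u i) (u j) = h (u i) (\<Sum>k\<in>UNIV. bact (u k) (P $ k $ j))"
        by (rule arg_cong)
      then show ?thesis
        by (simp add: h_sum u_E)
    qed
    then show ?thesis
      by (simp add: mat_mul_def H_def vec_eq_iff)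
  qed
  have PH: "mat_mul smul P H = H"
    using arg_cong[OF HP, of "mat_star (fps_star star)"] by (simp only: MM.star_mul H_star P_simps)
  have H_nth_0: "fps_nth (H $ i $ j) 0 = P\<^sub>0 $ i $ j" for i j
  proof -
    have "vec_fps_nth 0 (axis i (fps_const one)) = axis i one" for i :: 'n
      by (simp add: vec_fps_nth_def axis_def vec_eq_iff)
    then have f0: "vec_fps_nth 0 (f i) = e i" for i
      by (simp add: f_def e_def mat_vec_P_nth_0)
    \<comment> \<open>In order zero the \<open>u i\<close> are the columns of
      \<open>P\<^sub>0\<close>, so their Gram matrix is the adjoint of \<open>P\<^sub>0\<close>
      times \<open>P\<^sub>0\<close>.\<close>
    have "fps_nth (H $ i $ j) 0 = canonical_inner mul star (e i) (e j)"
      by (simp add: H_def h_nth_0 u_E) (simp add: u_def \<phi>_nth_0 f_M f0)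
    also have "\<dots> = mat_mul mul (mat_star star P\<^sub>0) P\<^sub>0 $ i $ j"
      by (simp add: canonical_inner_def e_def mat_vec_axis mat_mul_def mat_star_def)
    finally show ?thesis
      by (simp add: P_simps)
  qed
  \<comment> \<open>Adding \<open>1 - P\<close> makes the Gram matrix invertible without changing it on \<open>M\<close>.\<close>
  define G where "G = H + (mat_one (fps_const one) - P)"
  have P0_nth: "fps_nth (P $ i $ j) 0 = P\<^sub>0 $ i $ j" for i j
    using P_nth_0 by (auto simp: vec_eq_iff)
  have "G - mat_one (fps_const one) \<in> mat_fps_ideal 1"
    by (simp add: G_def mat_fps_ideal_def H_nth_0 P0_nth)
  moreover have "mat_star (fps_star star) G = G"
    by (simp add: G_def MM.star_add MM.star_diff H_star MM.star_one P_simps)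
  moreover have "mat_mul smul P G = mat_mul smul G P"
    by (simp add: G_def MM.mul_simps HP PH P_simps)
  ultimately obtain W where W: "mat_mul smul W (mat_mul smul G W) = mat_one (fps_const one)"
      "mat_star (fps_star star) W = W" "mat_mul smul P W = mat_mul smul W P"
      "W - mat_one (fps_const one) \<in> mat_fps_ideal 1"
    by (rule MM.inverse_sqrt)

  \<comment> \<open>The isometry obtained from the inverse square root\<close>
  have GP: "mat_mul smul P G = mat_mul smul G P"
    by fact
  have comm_M: "mat_vec smul L y \<in> M" if "mat_mul smul P L = mat_mul smul L P" "y \<in> M" for L y
    using that D.mat_vec_mul[of P L y] D.mat_vec_mul[of L P y] by (simp add: M_iff)
  have WM: "mat_vec smul W y \<in> M" if "y \<in> M" for y
    using W(3) that by (rule comm_M)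
  have GWM: "mat_vec smul (mat_mul smul G W) y \<in> M" if "y \<in> M" for y
    using comm_M[OF GP WM[OF that]] by (simp add: D.mat_vec_mul)
  \<comment> \<open>\<open>W\<close> has the left inverse \<open>W G\<close> and the right inverse
    \<open>G W\<close>; these coincide, so \<open>G W\<close> is a two-sided inverse.\<close>
  have inv: "mat_mul smul (mat_mul smul G W) W = mat_one (fps_const one)"
  proof -
    have "mat_mul smul (mat_mul smul W G) W = mat_one (fps_const one)"
      using W(1) by (simp add: MM.mul_assoc)
    then have "mat_mul smul W G = mat_mul smul G W"
      by (metis W(1) MM.mul_assoc MM.one_left MM.one_right)
    then show ?thesis
      using W(1) by (metis MM.mul_assoc)
  qed
  have "bij_betw (mat_vec smul W) M M"
    by (rule bij_betw_byWitness[of _ "mat_vec smul (mat_mul smul G W)"])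
      (use WM GWM in \<open>auto simp: D.mat_vec_mul inv W D.mat_vec_one\<close>)
  then have bij: "bij_betw (\<phi> \<circ> mat_vec smul W) M (fps_over E)"
    using bij_\<phi> by (rule bij_betw_trans)
  have isometric: "h (\<phi> (mat_vec smul W x)) (\<phi> (mat_vec smul W y)) = ipM x y" if "x \<in> M" "y \<in> M" for x y
  proof -
    define z where "z = mat_vec smul W y"
    have "mat_vec smul H z = mat_vec smul G z"
      using WM[OF that(2)] by (simp add: G_def z_def D.mat_vec_add_left D.mat_vec_diff_left D.mat_vec_one M_iff)
    then have "h (\<phi> (mat_vec smul W x)) (\<phi> z) = ipM (mat_vec smul W x) (mat_vec smul G z)"
      using WM that by (simp add: h_\<phi> z_def)
    also have "\<dots> = ipM x (mat_vec smul (mat_mul smul W (mat_mul smul G W)) y)"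
      by (simp add: D.canonical_inner_mat_vec W(2) z_def D.mat_vec_mul MM.mul_assoc)
    finally show ?thesis
      by (simp add: z_def W(1) D.mat_vec_one)
  qed
  have W_nth_0: "vec_fps_nth 0 (mat_vec smul W y) = vec_fps_nth 0 y" for y
  proof -
    have "(\<chi> i j. fps_nth (W $ i $ j) 0) = mat_one one"
      using W(4) by (auto simp: mat_fps_ideal_def mat_one_def vec_eq_iff)
    then show ?thesis
      by (simp add: vec_fps_nth_0_mat_vec mat_vec_one)
  qed
  show thesis
  proof
    show "isometry_on scaleM M (vec_act smul) ipM scaleE (fps_over E) bact h (\<phi> \<circ> mat_vec smul W)"
      using bij isometric
      by (simp add: isometry_on_def lin_on_def D.mat_vec_add D.mat_vec_scale \<phi>_add \<phi>_scale D.mat_vec_act \<phi>_act)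
    show "fps_nth ((\<phi> \<circ> mat_vec smul W) y) 0 = vec_fps_nth 0 y" if "y \<in> M" for y
      using that by (simp add: \<phi>_nth_0 WM W_nth_0)
  qed
qed

theorem hermitian_module_deformations_equivalent:
  assumes "hermitian_module_deformation scl one star smul (vec_scale scl) E (vec_act mul)
      (canonical_inner mul star) bact h"
    and "hermitian_module_deformation scl one star smul (vec_scale scl) E (vec_act mul)
      (canonical_inner mul star) bact' h'"
  shows "equivalent_deformations (vec_scale scl) E bact h bact' h'"
proof -
  obtain \<Phi> where \<Phi>: "isometry_on scaleM M (vec_act smul) ipM scaleE (fps_over E) bact h \<Phi>"
    and \<Phi>_0: "\<And>y. y \<in> M \<Longrightarrow> fps_nth (\<Phi> y) 0 = vec_fps_nth 0 y"
    using hermitian_module_deformation_trivialization[OF assms(1)] by blast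
  obtain \<Psi> where \<Psi>: "isometry_on scaleM M (vec_act smul) ipM scaleE (fps_over E) bact' h' \<Psi>"
    and \<Psi>_0: "\<And>y. y \<in> M \<Longrightarrow> fps_nth (\<Psi> y) 0 = vec_fps_nth 0 y"
    using hermitian_module_deformation_trivialization[OF assms(2)] by blast
  have "isometry_on scaleE (fps_over E) bact h scaleE (fps_over E) bact' h' (\<Psi> \<circ> inv_into M \<Phi>)"
    using isometry_on_compose[OF isometry_on_inv_into[OF \<Phi> D.right_module_projection_module] \<Psi>] .
  \<comment> \<open>Both isometries preserve order zero, so the composite fixes the constant
    term.\<close>
  moreover have "fps_nth ((\<Psi> \<circ> inv_into M \<Phi>) (fps_const x)) 0 = x" if "x \<in> E" for x
  proof -
    have "fps_const x \<in> \<Phi> ` M"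
      using \<Phi> fps_const_in_fps_over[OF that V.subspace_0[OF subspace_E]]
      by (simp add: isometry_on_def bij_betw_def)
    then have "inv_into M \<Phi> (fps_const x) \<in> M" "\<Phi> (inv_into M \<Phi> (fps_const x)) = fps_const x"
      by (simp_all add: inv_into_into f_inv_into_f)
    then show ?thesis
      using \<Phi>_0[of "inv_into M \<Phi> (fps_const x)"] \<Psi>_0[of "inv_into M \<Phi> (fps_const x)"] by simp
  qed
  ultimately show ?thesis
    by (intro equivalent_deformationsI V.module_axioms subspace_E)
qed

end

theorem proposition2p8:
  fixes scl :: "'r::rat_ordered_ring cx \<Rightarrow> 'a::ab_group_add \<Rightarrow> 'a"
    and mul :: "'a \<Rightarrow> 'a \<Rightarrow> 'a" and one :: 'a and star :: "'a \<Rightarrow> 'a"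
    and P\<^sub>0 :: "'a ^ 'n ^ 'n"
    and smul :: "'a fps \<Rightarrow> 'a fps \<Rightarrow> 'a fps"
  defines "E \<equiv> projection_module mul P\<^sub>0"
    and "h\<^sub>0 \<equiv> canonical_inner mul star"
  assumes "unital_star_algebra scl mul one star"
    and "projection mul star P\<^sub>0"
    and "hermitian_deformation scl mul one star smul"
    and "inner_product_module scl mul one star (vec_scale scl) E (vec_act mul) h\<^sub>0"
  shows "(\<exists>bact h. hermitian_module_deformation scl one star smul
            (vec_scale scl) E (vec_act mul) h\<^sub>0 bact h) \<and>
    (\<forall>bact h bact' h'.
        hermitian_module_deformation scl one star smul
            (vec_scale scl) E (vec_act mul) h\<^sub>0 bact h \<and>
        hermitian_module_deformation scl one star smul
            (vec_scale scl) E (vec_act mul) h\<^sub>0 bact' h' \<longrightarrow>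
        equivalent_deformations (vec_scale scl) E bact h bact' h')"
proof -
  interpret A: unital_star_algebra scl mul one star
    by fact
  interpret deformed_algebra scl mul one star smul
    by unfold_locales fact
  obtain P where P: "projection smul (fps_star star) P" "(\<chi> i j. fps_nth (P $ i $ j) 0) = P\<^sub>0"
    using lift_matrix_projection[OF assms(4)] by blast
  have "x = 0" if "x \<in> projection_module mul P\<^sub>0" "canonical_inner mul star x x = 0" for x
    using assms(6) that unfolding E_def h\<^sub>0_def A.inner_product_module_iff[OF assms(4)] by blast
  then interpret deformed_projection scl mul one star smul P\<^sub>0 P
    using assms(4) P by unfold_locales
  show ?thesis
    unfolding E_def h\<^sub>0_def
    using hermitian_module_deformation_exists hermitian_module_deformations_equivalent by blast
qed

end
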